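(* Let $M$ be a lattice of rank $n\ge 1$, let $p\in\mathbb{C}[M]$ be a Laurent polynomial with $\operatorname{supp}(p)$ unimodular and satisfying the generalized Einstein condition (GEC), and let $\sigma\in\Sigma_{\operatorname{NP}(p)}$. Then the translated initial part $p_{\sigma}\in\mathbb{C}[M\cap\sigma^{\perp}]$ also verifies that $\operatorname{supp}(p_{\sigma})$ is unimodular as a subset of the lattice $M\cap\sigma^{\perp}$, and $p_{\sigma}$ satisfies GEC.
   Context: $M_{\mathbb{R}}=M\otimes_{\mathbb{Z}}\mathbb{R}$, $N=M^{\vee}$ is the dual lattice, $N_{\mathbb{R}}=N\otimes_{\mathbb{Z}}\mathbb{R}$, and $\langle\cdot,\cdot\rangle$ is the pairing. $\mathbb{C}[M]$ is the group algebra, with monomials $\chi^{m}$. For a nonzero $p=\sum_{j=0}^{s}c_{j}\chi^{m_{j}}$ ($c_{j}\ne0$, $m_{j}$ distinct), $\operatorname{supp}(p)=\{m_{0},\dots,m_{s}\}$ and $\operatorname{NP}(p)=\operatorname{conv}(\operatorname{supp}(p))$. A finite subset $S$ of a lattice $M$ is unimodular if for every vertex $v$ of $\operatorname{conv}(S)$ and every edge $E$ of $\operatorname{conv}(S)$ containing $v$ there exists $w_{E}\in E\cap S$ such that the vectors $w_{E}-v$ (over all such edges $E$) form a basis of the lattice. For a face $F$ of $\operatorname{NP}(p)$, $\sigma_{F}=\{u\in N_{\mathbb{R}}\mid\langle u,x-y\rangle\ge0\text{ for all }x\in\operatorname{NP}(p),\,y\in F\}$; the normal fan is $\Sigma_{\operatorname{NP}(p)}=\{\sigma_{F}\}_{F}$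 over all faces $F$ of $\operatorname{NP}(p)$. For $\sigma\in\Sigma_{\operatorname{NP}(p)}$, let $\operatorname{NP}(p)_{\sigma}=\{y\in\operatorname{NP}(p)\mid\langle u,x-y\rangle\ge0\text{ for all }u\in\sigma,\,x\in\operatorname{NP}(p)\}$ and $\operatorname{init}_{\sigma}(p)=\sum_{m_{j}\in\operatorname{NP}(p)_{\sigma}}c_{j}\chi^{m_{j}}$. With $\sigma^{\perp}\subset M_{\mathbb{R}}$ the orthogonal subspace of $\sigma$, the translated initial part is $p_{\sigma}=\chi^{-m}\operatorname{init}_{\sigma}(p)\in\mathbb{C}[M\cap\sigma^{\perp}]$ for any choice of $m\in\operatorname{supp}(\operatorname{init}_{\sigma}(p))$. The operator $\mu$: let $M_{p}=M\cap\sum_{j,k}\mathbb{R}(m_{j}-m_{k})$ and $r=\operatorname{rank}(M_{p})$. Choosing a basis of $M_{p}$ identifies $\mathbb{C}[M_{p}]$ with $\mathbb{C}[y_{1}^{\pm1},\dots,y_{r}^{\pm1}]$; with $D_{i}=y_{i}\,\partial/\partial y_{i}$ one sets, for $q\ne0$, $\delta_{M_{p}}(q)=\det(D_{i}D_{j}\log q)_{i,j=1}^{r}$, where $D_{i}D_{j}\log q=\big(q\,D_{i}D_{j}q-(D_{i}q)(D_{j}q)\big)/q^{2}$ (independent of the basis; the empty determinant is $1$). Then $\mu(p)=p^{r+1}\,\delta_{M_{p}}(\chi^{-m_{0}}p)$, a Laurent polynomial in $\mathbb{C}[M]$ independent of the choice of $m_{0}\in\operatorname{supp}(p)$. A Laurent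 polynomial $p\in\mathbb{C}[M]$ with unimodular support satisfies GEC if $\mu(p)$ divides $p^{\kappa}$ in $\mathbb{C}[M]$ for some positive integer $\kappa$. *)

theory Defs
  imports
    "HOL-Analysis.Analysis"
    "HOL-Library.Poly_Mapping"
    "HOL-Computational_Algebra.Polynomial_Factorial"
    "Jordan_Normal_Form.Determinant"
begin

(* The symbol is also the scalar product of vectors over a ring; here it is the inner product. *)
no_notation Matrix.scalar_prod (infix "\<bullet>" 70)

section \<open>Lattices\<close>

text \<open>
  A lattice is the \<open>\<int>\<close>-span of a linearly independent set in a Euclidean space \<open>'a\<close>. When it spans
  \<open>'a\<close>, the type \<open>'a\<close> is \<open>M\<^sub>\<real>\<close>, and the rank is \<open>DIM('a) \<ge> 1\<close>. Sublattices such as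
  \<open>M \<inter> \<sigma>\<^sup>\<bottom>\<close> need not span and may be \<open>{0}\<close>. The dual space \<open>N\<^sub>\<real>\<close> is identified with \<open>'a\<close> by means
  of the inner product, so that \<open>\<langle>u, x\<rangle>\<close> is \<open>u \<bullet> x\<close>; the lattice \<open>M\<close> itself is arbitrary and not
  required to be compatible with the inner product.
\<close>

definition int_span :: "'a::real_vector set \<Rightarrow> 'a set" where
  "int_span B = {\<Sum>b\<in>B. of_int (c b) *\<^sub>R b | c :: 'a \<Rightarrow> int. True}"

definition lattice_basis :: "'a::euclidean_space set \<Rightarrow> 'a set \<Rightarrow> bool" where
  "lattice_basis B L \<longleftrightarrow> independent B \<and> int_span B = L"

definition is_lattice :: "'a::euclidean_space set \<Rightarrow> bool" where
  "is_lattice L \<longleftrightarrow> (\<exists>B. lattice_basis B L)"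

definition full_lattice :: "'a::euclidean_space set \<Rightarrow> bool" where
  "full_lattice L \<longleftrightarrow> is_lattice L \<and> span L = UNIV"

definition edges_at :: "'a::euclidean_space set \<Rightarrow> 'a \<Rightarrow> 'a set set" where
  "edges_at P v = {E. E edge_of P \<and> v \<in> E}"

definition unimodular :: "'a::euclidean_space set \<Rightarrow> 'a set \<Rightarrow> bool" where
  "unimodular L S \<longleftrightarrow> finite S \<and> S \<subseteq> L \<and>
     (\<forall>v. v extreme_point_of (convex hull S) \<longrightarrow>
        (\<exists>w. (\<forall>E \<in> edges_at (convex hull S) v. w E \<in> E \<inter> S) \<and>
             inj_on (\<lambda>E. w E - v) (edges_at (convex hull S) v) \<and>
             lattice_basis ((\<lambda>E. w E - v) ` edges_at (convex hull S) v) L))"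

section \<open>Laurent polynomials\<close>

text \<open>
  The group algebra of the additive group \<open>'a\<close>; \<open>\<complex>[L]\<close> is the subring of elements supported in \<open>L\<close>.
  This is a copy of the type \<open>'a \<Rightarrow>\<^sub>0 complex\<close>, whose existing instance of \<open>idom\<close> is restricted to
  linearly ordered exponents, whereas the fraction field is needed for exponents in a Euclidean space.
\<close>

typedef (overloaded) 'a laurent = "UNIV :: ('a::euclidean_space \<Rightarrow>\<^sub>0 complex) set"
  by simp

setup_lifting type_definition_laurent

instantiation laurent :: (euclidean_space) comm_ring_1
begin

lift_definition zero_laurent :: "'a laurent" is 0 .
lift_definition one_laurent :: "'a laurent" is 1 .
lift_definition plus_laurent :: "'a laurent \<Rightarrow> 'a laurent \<Rightarrow> 'a laurent" is "(+)" .
lift_definition minus_laurent :: "'a laurent \<Rightarrow> 'a laurent \<Rightarrow> 'a laurent" is "(-)" .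
lift_definition uminus_laurent :: "'a laurent \<Rightarrow> 'a laurent" is "uminus" .
lift_definition times_laurent :: "'a laurent \<Rightarrow> 'a laurent \<Rightarrow> 'a laurent" is "(*)" .

instance
  by standard (transfer, simp add: algebra_simps)+

end

lift_definition laurent_coeff :: "'a::euclidean_space laurent \<Rightarrow> 'a \<Rightarrow> complex" is Poly_Mapping.lookup .
lift_definition laurent_supp :: "'a::euclidean_space laurent \<Rightarrow> 'a set" is Poly_Mapping.keys .
lift_definition laurent_monom :: "complex \<Rightarrow> 'a::euclidean_space \<Rightarrow> 'a laurent"
  is "\<lambda>c m. Poly_Mapping.single m c" .

lemma exists_separating_vector:
  fixes A :: "'a::euclidean_space set"
  assumes "finite A"
  obtains u where "inj_on (\<lambda>x. u \<bullet> x) A"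
proof -
  let ?D = "{x - y | x y. x \<in> A \<and> y \<in> A \<and> x \<noteq> y}"
  have "?D \<subseteq> (\<lambda>(x, y). x - y) ` (A \<times> A)" by auto
  then have fin: "finite ?D"
    by (rule finite_subset) (intro finite_imageI finite_cartesian_product assms)
  have "negligible (\<Union>d\<in>?D. {x. d \<bullet> x = 0})"
  proof (rule negligible_Union)
    show "finite ((\<lambda>d. {x. d \<bullet> x = 0}) ` ?D)" using fin by (rule finite_imageI)
  next
    fix t assume "t \<in> (\<lambda>d. {x. d \<bullet> x = 0}) ` ?D"
    then show "negligible t" by (auto intro!: negligible_hyperplane)
  qed
  then have "(\<Union>d\<in>?D. {x. d \<bullet> x = 0}) \<noteq> UNIV"
    using non_negligible_UNIV by metis
  then obtain u where u: "\<And>d. d \<in> ?D \<Longrightarrow> d \<bullet> u \<noteq> 0" by blast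
  have "inj_on (\<lambda>x. u \<bullet> x) A"
  proof (rule inj_onI, rule ccontr)
    fix x y assume "x \<in> A" "y \<in> A" "u \<bullet> x = u \<bullet> y" "x \<noteq> y"
    then have "x - y \<in> ?D" by blast
    moreover have "(x - y) \<bullet> u = 0"
      using \<open>u \<bullet> x = u \<bullet> y\<close> by (simp add: inner_commute[of "x - y"] inner_diff_right)
    ultimately show False using u by blast
  qed
  then show thesis by (rule that)
qed

lemma poly_mapping_mult_nonzero:
  fixes p q :: "'a::euclidean_space \<Rightarrow>\<^sub>0 complex"
  assumes "p \<noteq> 0" "q \<noteq> 0"
  shows "p * q \<noteq> 0"
proof -
  obtain u where u: "inj_on (\<lambda>x. u \<bullet> x) (Poly_Mapping.keys p \<union> Poly_Mapping.keys q)"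
    using exists_separating_vector[of "Poly_Mapping.keys p \<union> Poly_Mapping.keys q"] by auto
  have max: "\<exists>a\<in>Poly_Mapping.keys r. \<forall>x\<in>Poly_Mapping.keys r. x \<noteq> a \<longrightarrow> u \<bullet> x < u \<bullet> a"
    if r: "r = p \<or> r = q" for r
  proof -
    have ne: "Poly_Mapping.keys r \<noteq> {}" and inj: "inj_on (\<lambda>x. u \<bullet> x) (Poly_Mapping.keys r)"
      using r assms u by (auto intro: inj_on_subset)
    let ?I = "(\<lambda>x. u \<bullet> x) ` Poly_Mapping.keys r"
    have "Max ?I \<in> ?I" using ne by (intro Max_in) auto
    then obtain a where a: "a \<in> Poly_Mapping.keys r" "u \<bullet> a = Max ?I" by auto
    have "u \<bullet> x < u \<bullet> a" if "x \<in> Poly_Mapping.keys r" "x \<noteq> a" for x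
    proof -
      have "u \<bullet> x \<le> u \<bullet> a" using that a by auto
      moreover have "u \<bullet> x \<noteq> u \<bullet> a" using inj_onD[OF inj, of x a] that a(1) by blast
      ultimately show ?thesis by simp
    qed
    with a show ?thesis by blast
  qed
  obtain a where a: "a \<in> Poly_Mapping.keys p"
      "\<And>x. x \<in> Poly_Mapping.keys p \<Longrightarrow> x \<noteq> a \<Longrightarrow> u \<bullet> x < u \<bullet> a"
    using max[of p] by blast
  obtain b where b: "b \<in> Poly_Mapping.keys q"
      "\<And>x. x \<in> Poly_Mapping.keys q \<Longrightarrow> x \<noteq> b \<Longrightarrow> u \<bullet> x < u \<bullet> b"
    using max[of q] by blast
  have uniq: "x = a \<and> y = b"
    if "x \<in> Poly_Mapping.keys p" "y \<in> Poly_Mapping.keys q" "a + b = x + y" for x y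
  proof -
    have "u \<bullet> a + u \<bullet> b = u \<bullet> x + u \<bullet> y"
      using that(3) by (metis inner_add_right)
    moreover have "x = a \<or> u \<bullet> x < u \<bullet> a" "y = b \<or> u \<bullet> y < u \<bullet> b"
      using a(2)[OF that(1)] b(2)[OF that(2)] by blast+
    ultimately show ?thesis by (elim disjE) simp_all
  qed
  have "Poly_Mapping.lookup (p * q) (a + b) =
      (\<Sum>x. Poly_Mapping.lookup p x * (\<Sum>y. Poly_Mapping.lookup q y when a + b = x + y))"
    by (simp add: lookup_mult)
  also have "\<dots> = (\<Sum>x. (Poly_Mapping.lookup p a * Poly_Mapping.lookup q b) when x = a)"
  proof (rule Sum_any.cong)
    fix x
    show "Poly_Mapping.lookup p x * (\<Sum>y. Poly_Mapping.lookup q y when a + b = x + y) =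
        (Poly_Mapping.lookup p a * Poly_Mapping.lookup q b when x = a)"
    proof (cases "x = a")
      case True
      then show ?thesis by (simp add: eq_commute[of b])
    next
      case False
      have "Poly_Mapping.lookup p x = 0 \<or>
          (\<forall>y. (Poly_Mapping.lookup q y when a + b = x + y) = 0)"
      proof (rule ccontr)
        assume "\<not> ?thesis"
        then obtain y where "x \<in> Poly_Mapping.keys p" "y \<in> Poly_Mapping.keys q" "a + b = x + y"
          by (auto simp: when_def in_keys_iff split: if_splits)
        with uniq False show False by blast
      qed
      with False show ?thesis by auto
    qed
  qed
  also have "\<dots> = Poly_Mapping.lookup p a * Poly_Mapping.lookup q b" by simp
  finally show ?thesis using a(1) b(1) by (auto simp: in_keys_iff)
qed

instance laurent :: (euclidean_space) idom
proof
  fix p q :: "'a laurent"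
  assume "p \<noteq> 0" "q \<noteq> 0"
  then show "p * q \<noteq> 0" by transfer (rule poly_mapping_mult_nonzero)
qed

definition laurent_ring :: "'a::euclidean_space set \<Rightarrow> 'a laurent set"  (\<open>\<complex>[_]\<close>) where
  "\<complex>[L] = {p. laurent_supp p \<subseteq> L}"

section \<open>Newton polytope, normal fan and initial parts\<close>

definition newton_polytope :: "'a::euclidean_space laurent \<Rightarrow> 'a set" where
  "newton_polytope p = convex hull laurent_supp p"

definition face_cone :: "'a::euclidean_space set \<Rightarrow> 'a set \<Rightarrow> 'a set" where
  "face_cone P F = {u. \<forall>x\<in>P. \<forall>y\<in>F. u \<bullet> (x - y) \<ge> 0}"

text \<open>\<open>face_of\<close> counts the empty set as a face; it indexes no cone of the fan.\<close>

definition normal_fan :: "'a::euclidean_space set \<Rightarrow> 'a set set" where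
  "normal_fan P = {face_cone P F | F. F face_of P \<and> F \<noteq> {}}"

definition cone_face :: "'a::euclidean_space set \<Rightarrow> 'a set \<Rightarrow> 'a set" where
  "cone_face P \<sigma> = {y\<in>P. \<forall>u\<in>\<sigma>. \<forall>x\<in>P. u \<bullet> (x - y) \<ge> 0}"

definition init_part :: "'a::euclidean_space set \<Rightarrow> 'a laurent \<Rightarrow> 'a laurent" where
  "init_part \<sigma> p =
     (\<Sum>m | m \<in> laurent_supp p \<and> m \<in> cone_face (newton_polytope p) \<sigma>.
        laurent_monom (laurent_coeff p m) m)"

section \<open>The operator \<open>\<mu>\<close> and the generalized Einstein condition\<close>

definition difference_lattice :: "'a::euclidean_space set \<Rightarrow> 'a laurent \<Rightarrow> 'a set" where
  "difference_lattice L p = L \<inter> span {m - m' | m m'. m \<in> laurent_supp p \<and> m' \<in> laurent_supp p}"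

text \<open>
  For an ordered lattice basis \<open>bs\<close> and \<open>y\<^sub>i = \<chi>\<^bsup>bs ! i\<^esup>\<close>, the operator \<open>D\<^sub>i = y\<^sub>i \<partial>/\<partial>y\<^sub>i\<close> multiplies
  \<open>\<chi>\<^bsup>m\<^esup> = \<Prod>\<^sub>j y\<^sub>j\<^bsup>e\<^sub>j\<^esup>\<close>, where \<open>m = \<Sum>\<^sub>j e\<^sub>j (bs ! j)\<close>, by the exponent \<open>e\<^sub>i\<close>.
\<close>

definition log_deriv :: "'a::euclidean_space list \<Rightarrow> nat \<Rightarrow> 'a laurent \<Rightarrow> 'a laurent" where
  "log_deriv bs i q =
     (\<Sum>m\<in>laurent_supp q.
        laurent_monom (of_real (representation (set bs) m (bs ! i)) * laurent_coeff q m) m)"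

definition DD_log :: "'a::euclidean_space list \<Rightarrow> nat \<Rightarrow> nat \<Rightarrow> 'a laurent \<Rightarrow> 'a laurent fract" where
  "DD_log bs i j q =
     Fract (q * log_deriv bs i (log_deriv bs j q) - log_deriv bs i q * log_deriv bs j q) (q\<^sup>2)"

definition delta :: "'a::euclidean_space list \<Rightarrow> 'a laurent \<Rightarrow> 'a laurent fract" where
  "delta bs q =
     Determinant.det (Matrix.mat (length bs) (length bs) (\<lambda>(i, j). DD_log bs i j q))"

text \<open>
  The value does not depend on the chosen basis of the lattice \<open>M\<^sub>p\<close> nor on the chosen exponent
  \<open>m\<^sub>0\<close>. It is formed in the fraction field of the group algebra.
\<close>

definition mu :: "'a::euclidean_space set \<Rightarrow> 'a laurent \<Rightarrow> 'a laurent fract" where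
  "mu L p =
     (let bs = (SOME bs. distinct bs \<and> lattice_basis (set bs) (difference_lattice L p));
          m\<^sub>0 = (SOME m. m \<in> laurent_supp p)
      in to_fract p ^ (length bs + 1) * delta bs (laurent_monom 1 (- m\<^sub>0) * p))"

text \<open>
  \<open>P\<close> is \<open>\<mu>(p)\<close> regarded as a Laurent polynomial, and divisibility is understood in \<open>\<complex>[L]\<close>.
\<close>

definition GEC :: "'a::euclidean_space set \<Rightarrow> 'a laurent \<Rightarrow> bool" where
  "GEC L p \<longleftrightarrow>
     (\<exists>P\<in>\<complex>[L]. to_fract P = mu L p \<and> (\<exists>\<kappa>>0. \<exists>Q\<in>\<complex>[L]. p ^ \<kappa> = P * Q))"

end

theory Submission
  imports Defs
begin

text \<open>
  Write \<open>\<Delta>\<close> for the polytope \<open>NP(p)\<close> and \<open>G\<close> for the face of \<open>\<Delta>\<close> on which every \<open>u \<in> \<sigma>\<close> attains its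
  minimum, so that the support of \<open>init\<^sub>\<sigma>(p)\<close> is \<open>supp(p) \<inter> G\<close>. The theorem is the
  combination of a statement about lattices and one about determinants.

  \<^bold>\<open>Lattices.\<close> At a vertex \<open>v\<close> of \<open>G\<close> unimodularity provides a basis of \<open>M\<close> consisting of vectors
  \<open>w\<^sub>E - v\<close> along the edges of \<open>\<Delta>\<close> at \<open>v\<close>. A polytope lies in the cone spanned by its edges at a
  vertex (\<open>convex_hull_subset_edge_cone\<close>); hence the points of \<open>\<Delta> - v\<close> have nonnegative coordinates
  in this basis, and \<open>G\<close> is the part of \<open>\<Delta>\<close> on which the coordinates belonging to edges outside \<open>G\<close>
  vanish. These coordinate functionals therefore lie in \<open>\<sigma>\<close>, and this forces the vectors
  belonging to edges inside \<open>G\<close> to be a basis of \<open>M \<inter> \<sigma>\<^sup>\<bottom>\<close> (\<open>lattice_basis_face\<close>).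

  \<^bold>\<open>Determinants.\<close> With \<open>f\<^sub>1, \<dots>, f\<^sub>r\<close> the coordinates of the exponents and \<open>f\<^sub>0 = 1\<close>, a Schur complement
  turns \<open>q\<^sup>r\<^sup>+\<^sup>1 det(D\<^sub>iD\<^sub>j log q)\<close> into the determinant of the bordered Hessian, whose entries
  are \<open>\<Sum>\<^sub>m f\<^sub>i(m) f\<^sub>j(m) c\<^sub>m \<chi>\<^sup>m\<close> for \<open>0 \<le> i, j \<le> r\<close> (\<open>bordered_hessian_eq_delta\<close>). This is visibly a
  Laurent polynomial, and an affine change of the \<open>f\<^sub>i\<close> multiplies it by a constant. So GEC may be
  tested on \<open>q = \<chi>\<^sup>-\<^sup>v p\<close> in the edge basis at \<open>v\<close> (\<open>GEC_iff_bordered_hessian\<close>).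

  In that basis \<open>q\<close> is a polynomial in variables \<open>y\<^sub>1, \<dots>, y\<^sub>n\<close>, and setting the variables of the edges
  outside \<open>G\<close> to zero turns \<open>q\<close> into \<open>q\<^sub>G = \<chi>\<^sup>-\<^sup>v init\<^sub>\<sigma>(p)\<close>. Row \<open>j\<close> of the bordered Hessian is divisible by
  \<open>y\<^sub>j\<close>. After dividing the rows of the edges outside \<open>G\<close> by their variables and setting these
  variables to zero, the matrix becomes block triangular, with the bordered Hessian matrix of \<open>q\<^sub>G\<close> as
  one block and a diagonal matrix as the other. A diagonal entry has constant term the coefficient of
  \<open>q\<close> at \<open>y\<^sub>j\<close>, which is nonzero because \<open>w\<^sub>E\<close> lies in the support of \<open>p\<close>
  (\<open>bordered_hessian_lowest_part\<close>). The case in which all variables are set to zero shows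
  that bordered Hessians of this kind do not vanish. Hence, if the bordered Hessian of \<open>q\<close> divides
  \<open>q\<^sup>\<kappa>\<close>, taking lowest parts in this identity shows that the one of \<open>q\<^sub>G\<close> divides \<open>q\<^sub>G\<^sup>\<kappa>\<close>, and dropping
  from the cofactor the monomials outside \<open>M \<inter> \<sigma>\<^sup>\<bottom>\<close> gives divisibility in \<open>\<complex>[M \<inter> \<sigma>\<^sup>\<bottom>]\<close>.
\<close>

section \<open>Laurent polynomials and their coefficients\<close>

lemma laurent_eqI: "(\<And>m. laurent_coeff p m = laurent_coeff q m) \<Longrightarrow> p = q"
  by transfer (rule poly_mapping_eqI)

lemma finite_laurent_supp [simp, intro]: "finite (laurent_supp p)"
  by transfer simp

lemma in_laurent_supp_iff: "m \<in> laurent_supp p \<longleftrightarrow> laurent_coeff p m \<noteq> 0"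
  by transfer (simp add: in_keys_iff)

lemma laurent_supp_0 [simp]: "laurent_supp 0 = {}"
  by transfer simp

lemma laurent_supp_eq_empty_iff: "laurent_supp p = {} \<longleftrightarrow> p = 0"
  by transfer simp

lemma laurent_coeff_0 [simp]: "laurent_coeff 0 m = 0"
  by transfer simp

lemma laurent_coeff_add [simp]: "laurent_coeff (p + q) m = laurent_coeff p m + laurent_coeff q m"
  by transfer (simp add: lookup_add)

lemma laurent_coeff_uminus [simp]: "laurent_coeff (- p) m = - laurent_coeff p m"
  by transfer simp

lemma laurent_coeff_sum [simp]:
  "laurent_coeff (\<Sum>i\<in>A. f i) m = (\<Sum>i\<in>A. laurent_coeff (f i) m)"
  by (induction A rule: infinite_finite_induct) simp_all

lemma laurent_coeff_monom: "laurent_coeff (laurent_monom c a) m = (if m = a then c else 0)"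
  by transfer (simp add: lookup_single when_def)

lemma laurent_monom_0_eq_1: "laurent_monom 1 0 = 1"
  by transfer simp

lemma laurent_monom_mult:
  "laurent_monom c a * laurent_monom d b = laurent_monom (c * d) (a + b)"
  by transfer (simp add: mult_single)

lemma laurent_monom_power: "laurent_monom 1 a ^ k = laurent_monom 1 (of_nat k *\<^sub>R a)"
  by (induction k) (simp_all add: laurent_monom_0_eq_1 laurent_monom_mult scaleR_left_distrib)

lemma laurent_coeff_mult:
  assumes "finite A" "laurent_supp p \<subseteq> A"
  shows "laurent_coeff (p * q) m = (\<Sum>x\<in>A. laurent_coeff p x * laurent_coeff q (m - x))"
  using assms
proof transfer
  fix A and p q :: "'a \<Rightarrow>\<^sub>0 complex" and m
  assume A: "finite A" "Poly_Mapping.keys p \<subseteq> A"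
  have "(Sum_any (\<lambda>y. Poly_Mapping.lookup q y when m = x + y)) = Poly_Mapping.lookup q (m - x)" for x
  proof -
    have "(Sum_any (\<lambda>y. Poly_Mapping.lookup q y when m = x + y)) = (Sum_any (\<lambda>y. Poly_Mapping.lookup q (m - x) when y = m - x))"
      by (rule Sum_any.cong) (auto simp: when_def)
    then show ?thesis by simp
  qed
  then have "Poly_Mapping.lookup (p * q) m = (Sum_any (\<lambda>x. Poly_Mapping.lookup p x * Poly_Mapping.lookup q (m - x)))"
    by (simp add: lookup_mult)
  also have "\<dots> = (\<Sum>x\<in>A. Poly_Mapping.lookup p x * Poly_Mapping.lookup q (m - x))"
    using A by (intro Sum_any.expand_superset) (auto simp: in_keys_iff)
  finally show "Poly_Mapping.lookup (p * q) m = (\<Sum>x\<in>A. Poly_Mapping.lookup p x * Poly_Mapping.lookup q (m - x))" .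
qed

lemma laurent_coeff_monom_mult:
  "laurent_coeff (laurent_monom c a * q) m = c * laurent_coeff q (m - a)"
  by (subst laurent_coeff_mult[of "{a}"])
     (auto simp: in_laurent_supp_iff laurent_coeff_monom split: if_splits)

lemma laurent_supp_mult: "laurent_supp (p * q) \<subseteq> {a + b | a b. a \<in> laurent_supp p \<and> b \<in> laurent_supp q}"
proof
  fix m assume "m \<in> laurent_supp (p * q)"
  then have "(\<Sum>x\<in>laurent_supp p. laurent_coeff p x * laurent_coeff q (m - x)) \<noteq> 0"
    by (simp add: in_laurent_supp_iff laurent_coeff_mult[of "laurent_supp p"])
  then obtain x where "x \<in> laurent_supp p" "laurent_coeff p x * laurent_coeff q (m - x) \<noteq> 0"
    by (meson sum.neutral)
  then show "m \<in> {a + b | a b. a \<in> laurent_supp p \<and> b \<in> laurent_supp q}"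
    by (intro CollectI exI[of _ x] exI[of _ "m - x"]) (auto simp: in_laurent_supp_iff)
qed

lemma laurent_supp_monom_mult: "laurent_supp (laurent_monom 1 a * q) = (\<lambda>m. a + m) ` laurent_supp q"
proof -
  have "m \<in> (\<lambda>m. a + m) ` X \<longleftrightarrow> m - a \<in> X" for m X
    by (metis add_diff_cancel_left' diff_add_cancel add.commute image_iff)
  then show ?thesis by (auto simp: in_laurent_supp_iff laurent_coeff_monom_mult)
qed

lemma laurent_monom_eq_0_iff [simp]: "laurent_monom c a = 0 \<longleftrightarrow> c = 0"
  by transfer (metis lookup_single_eq lookup_zero single_zero)

lemma laurent_monom_cancel: "laurent_monom 1 (- a) * (laurent_monom 1 a * q) = q"
  "laurent_monom 1 a * (laurent_monom 1 (- a) * q) = q"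
  by (simp_all add: mult.assoc[symmetric] laurent_monom_mult laurent_monom_0_eq_1)

text \<open>
  Termwise multiplication of the coefficients by a weight. Logarithmic derivatives (weight a coordinate
  of the exponent) and truncations to a set of exponents (weight an indicator) are both of this form,
  so that they commute.
\<close>

definition weighted :: "('a::euclidean_space \<Rightarrow> complex) \<Rightarrow> 'a laurent \<Rightarrow> 'a laurent" where
  "weighted w q = (\<Sum>m\<in>laurent_supp q. laurent_monom (w m * laurent_coeff q m) m)"

lemma laurent_coeff_weighted [simp]: "laurent_coeff (weighted w q) m = w m * laurent_coeff q m"
proof -
  have "laurent_coeff (weighted w q) m =
      (\<Sum>x\<in>laurent_supp q. if m = x then w m * laurent_coeff q m else 0)"
    unfolding weighted_def by (simp add: laurent_coeff_monom cong: if_cong sum.cong)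
  then show ?thesis by (simp add: sum.delta' in_laurent_supp_iff)
qed

lemma weighted_one [simp]: "weighted (\<lambda>m. 1) q = q"
  by (rule laurent_eqI) simp

lemma weighted_weighted: "weighted w (weighted w' q) = weighted (\<lambda>m. w m * w' m) q"
  by (rule laurent_eqI) simp

lemma weighted_cong:
  "(\<And>m. m \<in> laurent_supp q \<Longrightarrow> w m = w' m) \<Longrightarrow> weighted w q = weighted w' q"
  by (rule laurent_eqI) (metis in_laurent_supp_iff laurent_coeff_weighted mult_zero_right)

lemma laurent_supp_weighted: "laurent_supp (weighted w q) = {m \<in> laurent_supp q. w m \<noteq> 0}"
  by (auto simp: in_laurent_supp_iff)

lemma weighted_monom_mult:
  "weighted w (laurent_monom 1 a * q) = laurent_monom 1 a * weighted (\<lambda>m. w (a + m)) q"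
  by (rule laurent_eqI) (simp add: laurent_coeff_monom_mult)

abbreviation restrict_supp :: "'a::euclidean_space set \<Rightarrow> 'a laurent \<Rightarrow> 'a laurent" where
  "restrict_supp X \<equiv> weighted (indicator X)"

lemma laurent_supp_restrict: "laurent_supp (restrict_supp X q) = laurent_supp q \<inter> X"
  by (auto simp: laurent_supp_weighted indicator_def)

lemma restrict_supp_id: "laurent_supp q \<subseteq> X \<Longrightarrow> restrict_supp X q = q"
  by (subst weighted_cong[of q _ "\<lambda>m. 1"]) auto

lemma restrict_supp_zero: "laurent_supp q \<inter> X = {} \<Longrightarrow> restrict_supp X q = 0"
  by (simp add: laurent_supp_eq_empty_iff[symmetric] laurent_supp_restrict)

lemma weighted_sum: "weighted w (\<Sum>i\<in>A. f i) = (\<Sum>i\<in>A. weighted w (f i))"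
  by (rule laurent_eqI) (simp add: sum_distrib_left)

lemma weighted_uminus: "weighted w (- q) = - weighted w q"
  by (rule laurent_eqI) simp

lemma laurent_ring_mult:
  assumes "\<And>x y. x \<in> L \<Longrightarrow> y \<in> L \<Longrightarrow> x + y \<in> L" "p \<in> \<complex>[L]" "q \<in> \<complex>[L]"
  shows "p * q \<in> \<complex>[L]"
  using assms laurent_supp_mult[of p q] unfolding laurent_ring_def by blast

lemma laurent_ring_add: "p \<in> \<complex>[L] \<Longrightarrow> q \<in> \<complex>[L] \<Longrightarrow> p + q \<in> \<complex>[L]"
  unfolding laurent_ring_def by (auto simp: in_laurent_supp_iff subset_eq)

lemma laurent_ring_sum: "(\<And>i. i \<in> A \<Longrightarrow> f i \<in> \<complex>[L]) \<Longrightarrow> (\<Sum>i\<in>A. f i) \<in> \<complex>[L]"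
  by (induction A rule: infinite_finite_induct)
     (auto simp: laurent_ring_add, simp_all add: laurent_ring_def)

lemma laurent_ring_uminus: "p \<in> \<complex>[L] \<Longrightarrow> - p \<in> \<complex>[L]"
  unfolding laurent_ring_def by (auto simp: in_laurent_supp_iff subset_eq)

lemma laurent_ring_monom: "a \<in> L \<Longrightarrow> laurent_monom c a \<in> \<complex>[L]"
  unfolding laurent_ring_def by (auto simp: in_laurent_supp_iff laurent_coeff_monom split: if_splits)

lemma laurent_ring_weighted: "q \<in> \<complex>[L] \<Longrightarrow> weighted w q \<in> \<complex>[L]"
  unfolding laurent_ring_def by (auto simp: laurent_supp_weighted)

lemma laurent_ring_power:
  assumes "\<And>x y. x \<in> L \<Longrightarrow> y \<in> L \<Longrightarrow> x + y \<in> L" "0 \<in> L" "p \<in> \<complex>[L]"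
  shows "p ^ k \<in> \<complex>[L]"
proof (induction k)
  case 0
  then show ?case using laurent_ring_monom[OF assms(2), of 1] by (simp add: laurent_monom_0_eq_1)
next
  case (Suc k)
  then show ?case using laurent_ring_mult[OF assms(1,3)] by simp
qed

lemma laurent_ring_prod:
  assumes "\<And>x y. x \<in> L \<Longrightarrow> y \<in> L \<Longrightarrow> x + y \<in> L" "0 \<in> L" "\<And>i. i \<in> A \<Longrightarrow> f i \<in> \<complex>[L]"
  shows "(\<Prod>i\<in>A. f i) \<in> \<complex>[L]"
  using assms(3)
proof (induction A rule: infinite_finite_induct)
  case (insert i A)
  then show ?case using laurent_ring_mult[OF assms(1)] by simp
qed (use laurent_ring_monom[OF assms(2), of 1] in \<open>simp_all add: laurent_monom_0_eq_1\<close>)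

lemma laurent_ring_det:
  assumes "\<And>x y. x \<in> L \<Longrightarrow> y \<in> L \<Longrightarrow> x + y \<in> L" "0 \<in> L" "A \<in> carrier_mat n n"
    "\<And>i j. i < n \<Longrightarrow> j < n \<Longrightarrow> A $$ (i, j) \<in> \<complex>[L]"
  shows "Determinant.det A \<in> \<complex>[L]"
proof -
  have "signof \<pi> * (\<Prod>i = 0..<n. A $$ (i, \<pi> i)) \<in> \<complex>[L]" if "\<pi> permutes {0..<n}" for \<pi>
  proof -
    have "(\<Prod>i = 0..<n. A $$ (i, \<pi> i)) \<in> \<complex>[L]"
      using assms that by (intro laurent_ring_prod) (auto simp: permutes_in_image[OF that])
    then show ?thesis by (auto simp: sign_def laurent_ring_uminus)
  qed
  then show ?thesis unfolding det_def'[OF assms(3)] by (intro laurent_ring_sum) auto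
qed

section \<open>Lowest parts with respect to a linear functional\<close>

text \<open>
  The part of lowest \<open>u\<close>-degree is multiplicative: a product of monomials attains the sum of the lower
  bounds only if both factors attain theirs.
\<close>

lemma restrict_supp_mult_lowest:
  fixes u :: "'a::euclidean_space \<Rightarrow> real"
  assumes "linear u" "laurent_supp p \<subseteq> {m. a \<le> u m}" "laurent_supp q \<subseteq> {m. b \<le> u m}"
  shows "restrict_supp {m. u m = a + b} (p * q) =
    restrict_supp {m. u m = a} p * restrict_supp {m. u m = b} q"
proof (rule laurent_eqI)
  fix m
  have u: "u (m - x) = u m - u x" for x using linear_diff[OF assms(1)] .
  have "indicator {m. u m = a + b} m * (laurent_coeff p x * laurent_coeff q (m - x)) =
    indicator {m. u m = a} x * laurent_coeff p x * (indicator {m. u m = b} (m - x) * laurent_coeff q (m - x))"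
    for x
  proof (cases "laurent_coeff p x = 0 \<or> laurent_coeff q (m - x) = 0")
    case False
    then have "a \<le> u x" "b \<le> u (m - x)" using assms by (auto simp: in_laurent_supp_iff)
    then show ?thesis by (auto simp: indicator_def u)
  qed auto
  then show "laurent_coeff (restrict_supp {m. u m = a + b} (p * q)) m =
      laurent_coeff (restrict_supp {m. u m = a} p * restrict_supp {m. u m = b} q) m"
    unfolding laurent_coeff_weighted laurent_coeff_mult[OF finite_laurent_supp order_refl, of p]
      laurent_coeff_mult[OF finite_laurent_supp, of "restrict_supp {m. u m = a} p" p, unfolded laurent_supp_weighted, OF Collect_restrict]
      sum_distrib_left
    by (intro sum.cong) auto
qed

text \<open>
  Truncation to a subgroup \<open>L\<close> is linear over \<open>\<complex>[L]\<close>, because translation by an element of \<open>L\<close> preserves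
  both \<open>L\<close> and its complement. Thus a divisibility between elements of \<open>\<complex>[L]\<close> that holds in a larger ring
  holds in \<open>\<complex>[L]\<close>.
\<close>

lemma restrict_supp_mult_subring:
  assumes L: "\<And>x y. x \<in> L \<Longrightarrow> y \<in> L \<Longrightarrow> x + y \<in> L" "\<And>x y. x \<in> L \<Longrightarrow> y \<in> L \<Longrightarrow> x - y \<in> L"
    and p: "p \<in> \<complex>[L]"
  shows "restrict_supp L (p * q) = p * restrict_supp L q"
proof (rule laurent_eqI)
  fix m
  have "indicator L m * (laurent_coeff p x * laurent_coeff q (m - x)) =
    laurent_coeff p x * (indicator L (m - x) * laurent_coeff q (m - x))" for x
  proof (cases "x \<in> laurent_supp p")
    case True
    then have "x \<in> L" using p by (auto simp: laurent_ring_def)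
    then have "m \<in> L \<longleftrightarrow> m - x \<in> L" using L(1)[of "m - x" x] L(2)[of m x] by auto
    then show ?thesis by (auto simp: indicator_def)
  qed (auto simp: in_laurent_supp_iff)
  then show "laurent_coeff (restrict_supp L (p * q)) m = laurent_coeff (p * restrict_supp L q) m"
    unfolding laurent_coeff_weighted laurent_coeff_mult[OF finite_laurent_supp order_refl, of p]
      sum_distrib_left
    by (intro sum.cong) auto
qed

text \<open>
  Lowest degrees add up, and that of \<open>R\<close> is \<open>0\<close>; so a negative exponent in the cofactor \<open>Q\<close> would persist
  in \<open>R * Q\<close>.
\<close>

lemma supp_cofactor_nonneg:
  fixes u :: "'a::euclidean_space \<Rightarrow> real"
  assumes u: "linear u" and R: "laurent_supp R \<subseteq> {m. 0 \<le> u m}" "restrict_supp {m. u m = 0} R \<noteq> 0"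
    and T: "laurent_supp (R * Q) \<subseteq> {m. 0 \<le> u m}"
  shows "laurent_supp Q \<subseteq> {m. 0 \<le> u m}"
proof (cases "Q = 0")
  case False
  define b where "b = Min (u ` laurent_supp Q)"
  have ne: "u ` laurent_supp Q \<noteq> {}" using False by (simp add: laurent_supp_eq_empty_iff)
  have le: "laurent_supp Q \<subseteq> {m. b \<le> u m}" unfolding b_def by auto
  have "b \<in> u ` laurent_supp Q" unfolding b_def using ne by (intro Min_in) auto
  then have "restrict_supp {m. u m = b} Q \<noteq> 0"
    by (auto simp: laurent_supp_eq_empty_iff[symmetric] laurent_supp_restrict)
  then have "restrict_supp {m. u m = 0 + b} (R * Q) \<noteq> 0"
    unfolding restrict_supp_mult_lowest[OF u R(1) le] using R(2) by simp
  then obtain m where "m \<in> laurent_supp (R * Q)" "u m = b"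
    by (auto simp: laurent_supp_eq_empty_iff[symmetric] laurent_supp_restrict)
  then have "0 \<le> b" using T by auto
  then show ?thesis using le by auto
qed simp

lemma restrict_supp_one:
  fixes u :: "'a::euclidean_space \<Rightarrow> real"
  assumes "linear u" shows "restrict_supp {m. u m = 0} 1 = 1"
  by (rule restrict_supp_id)
     (auto simp: in_laurent_supp_iff laurent_monom_0_eq_1[symmetric] laurent_coeff_monom linear_0[OF assms] split: if_splits)

text \<open>
  On Laurent polynomials with exponents in the half space \<open>u \<ge> 0\<close>, truncation to the hyperplane
  \<open>u = 0\<close> is a ring homomorphism: it sets the variables of positive degree to zero. It does not extend to
  a homomorphism on the whole ring, so its compatibility with products, powers and determinants is
  shown on this subring.
\<close>

lemma restrict_supp_mult_nonneg:
  fixes u :: "'a::euclidean_space \<Rightarrow> real"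
  assumes "linear u" "p \<in> \<complex>[{m. 0 \<le> u m}]" "q \<in> \<complex>[{m. 0 \<le> u m}]"
  shows "restrict_supp {m. u m = 0} (p * q) = restrict_supp {m. u m = 0} p * restrict_supp {m. u m = 0} q"
  using restrict_supp_mult_lowest[OF assms(1), of p 0 q 0] assms(2,3)
  by (simp add: laurent_ring_def)

lemma nonneg_closed:
  fixes u :: "'a::euclidean_space \<Rightarrow> real" assumes "linear u"
  shows "\<And>x y. x \<in> {m. 0 \<le> u m} \<Longrightarrow> y \<in> {m. 0 \<le> u m} \<Longrightarrow> x + y \<in> {m. 0 \<le> u m}"
    "0 \<in> {m. 0 \<le> u m}"
  by (simp_all add: linear_add[OF assms] linear_0[OF assms])

lemma restrict_supp_prod_nonneg:
  fixes u :: "'a::euclidean_space \<Rightarrow> real"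
  assumes u: "linear u" and "\<And>i. i \<in> A \<Longrightarrow> f i \<in> \<complex>[{m. 0 \<le> u m}]"
  shows "restrict_supp {m. u m = 0} (\<Prod>i\<in>A. f i) = (\<Prod>i\<in>A. restrict_supp {m. u m = 0} (f i))"
  using assms(2)
proof (induction A rule: infinite_finite_induct)
  case (insert i A)
  have "(\<Prod>i\<in>A. f i) \<in> \<complex>[{m. 0 \<le> u m}]"
    using insert by (intro laurent_ring_prod nonneg_closed[OF u]) auto
  then show ?case using insert by (simp add: restrict_supp_mult_nonneg[OF u])
qed (simp_all add: restrict_supp_one[OF u])

lemma restrict_supp_power_nonneg:
  fixes u :: "'a::euclidean_space \<Rightarrow> real"
  assumes "linear u" "p \<in> \<complex>[{m. 0 \<le> u m}]"
  shows "restrict_supp {m. u m = 0} (p ^ k) = restrict_supp {m. u m = 0} p ^ k"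
  using restrict_supp_prod_nonneg[OF assms(1), of "{..<k}" "\<lambda>_. p"] assms(2) by simp

lemma restrict_supp_det_nonneg:
  fixes u :: "'a::euclidean_space \<Rightarrow> real"
  assumes u: "linear u" and A: "A \<in> carrier_mat n n"
    and nn: "\<And>i j. i < n \<Longrightarrow> j < n \<Longrightarrow> A $$ (i, j) \<in> \<complex>[{m. 0 \<le> u m}]"
  shows "restrict_supp {m. u m = 0} (Determinant.det A) =
    Determinant.det (map_mat (restrict_supp {m. u m = 0}) A)"
proof -
  let ?r = "restrict_supp {m. u m = 0}"
  have "?r (signof \<pi> * (\<Prod>i = 0..<n. A $$ (i, \<pi> i))) =
      signof \<pi> * (\<Prod>i = 0..<n. ?r (A $$ (i, \<pi> i)))" if "\<pi> permutes {0..<n}" for \<pi>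
  proof -
    have "?r (\<Prod>i = 0..<n. A $$ (i, \<pi> i)) = (\<Prod>i = 0..<n. ?r (A $$ (i, \<pi> i)))"
      using that by (intro restrict_supp_prod_nonneg[OF u] nn) (auto simp: permutes_in_image[OF that])
    then show ?thesis by (auto simp: sign_def weighted_uminus)
  qed
  then have "?r (Determinant.det A) =
      (\<Sum>\<pi> | \<pi> permutes {0..<n}. signof \<pi> * (\<Prod>i = 0..<n. ?r (A $$ (i, \<pi> i))))"
    unfolding det_def'[OF A] weighted_sum by (intro sum.cong) auto
  also have "\<dots> = (\<Sum>\<pi> | \<pi> permutes {0..<n}. signof \<pi> * (\<Prod>i = 0..<n. map_mat ?r A $$ (i, \<pi> i)))"
    using A by (intro sum.cong prod.cong arg_cong2[where f = "(*)"] refl) (auto dest: permutes_in_image)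
  also have "\<dots> = Determinant.det (map_mat ?r A)"
    using A by (intro det_def'[symmetric]) simp
  finally show ?thesis .
qed

section \<open>Lattices spanned by independent sets\<close>

lemma int_spanI: "(\<Sum>b\<in>B. of_int (c b) *\<^sub>R b) \<in> int_span B"
  unfolding int_span_def by blast

lemma int_spanE:
  assumes "x \<in> int_span B"
  obtains c where "x = (\<Sum>b\<in>B. of_int (c b) *\<^sub>R b)"
  using assms unfolding int_span_def by blast

lemma int_span_closed:
  assumes "finite B"
  shows "0 \<in> int_span B" "x \<in> int_span B \<Longrightarrow> y \<in> int_span B \<Longrightarrow> x + y \<in> int_span B"
    "x \<in> int_span B \<Longrightarrow> - x \<in> int_span B"
proof -
  show "0 \<in> int_span B" using int_spanI[of "\<lambda>_. 0" B] by simp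
  show "x + y \<in> int_span B" if xy: "x \<in> int_span B" "y \<in> int_span B"
  proof -
    obtain c d where "x = (\<Sum>b\<in>B. of_int (c b) *\<^sub>R b)" "y = (\<Sum>b\<in>B. of_int (d b) *\<^sub>R b)"
      using xy by (metis int_spanE)
    then have "x + y = (\<Sum>b\<in>B. of_int (c b + d b) *\<^sub>R b)"
      by (simp add: scaleR_left_distrib sum.distrib)
    then show ?thesis using int_spanI[of "\<lambda>b. c b + d b" B] by simp
  qed
  show "- x \<in> int_span B" if x: "x \<in> int_span B"
  proof -
    obtain c where "x = (\<Sum>b\<in>B. of_int (c b) *\<^sub>R b)"
      using x by (rule int_spanE)
    then have "- x = (\<Sum>b\<in>B. of_int (- c b) *\<^sub>R b)" by (simp add: sum_negf)
    then show ?thesis using int_spanI[of "\<lambda>b. - c b" B] by simp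
  qed
qed

lemma int_span_superset:
  assumes "finite B" shows "B \<subseteq> int_span B"
proof
  fix x assume "x \<in> B"
  have "(\<Sum>b\<in>B. of_int (if b = x then 1 else 0) *\<^sub>R b) = (\<Sum>b\<in>B. if b = x then b else 0)"
    by (intro sum.cong) auto
  also have "\<dots> = x" using assms \<open>x \<in> B\<close> by simp
  finally show "x \<in> int_span B" using int_spanI[of "\<lambda>b. if b = x then 1 else 0" B] by simp
qed

lemma int_span_subset_span: "int_span B \<subseteq> span B"
proof
  fix x assume "x \<in> int_span B"
  then obtain c where "x = (\<Sum>b\<in>B. of_int (c b) *\<^sub>R b)" by (rule int_spanE)
  then show "x \<in> span B" by (simp add: span_sum span_scale span_base)
qed

lemma span_int_span: "finite B \<Longrightarrow> span (int_span B) = span B"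
  by (metis int_span_subset_span int_span_superset span_mono span_span subset_antisym)

lemma lattice_basis_closed:
  assumes "lattice_basis B L"
  shows "0 \<in> L" "x \<in> L \<Longrightarrow> y \<in> L \<Longrightarrow> x + y \<in> L" "x \<in> L \<Longrightarrow> - x \<in> L"
    "x \<in> L \<Longrightarrow> y \<in> L \<Longrightarrow> x - y \<in> L" "x \<in> L \<Longrightarrow> of_nat k *\<^sub>R x \<in> L" "B \<subseteq> L" "span L = span B"
proof -
  have B: "finite B" "L = int_span B"
    using assms independent_imp_finite by (auto simp: lattice_basis_def)
  note c = int_span_closed[OF B(1), folded B(2)]
  show "0 \<in> L" by (rule c)
  show add: "x + y \<in> L" if "x \<in> L" "y \<in> L" for x y using that by (rule c)
  show min: "- x \<in> L" if "x \<in> L" for x using that by (rule c)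
  show "x - y \<in> L" if "x \<in> L" "y \<in> L" using add[OF that(1) min[OF that(2)]] by simp
  show "of_nat k *\<^sub>R x \<in> L" if "x \<in> L"
    by (induction k) (simp_all add: c(1) scaleR_left_distrib add that)
  show "B \<subseteq> L" "span L = span B" using int_span_superset span_int_span B by auto
qed

lemma representation_int_span:
  assumes "independent B" "x \<in> int_span B"
  shows "representation B x b \<in> \<int>"
proof -
  obtain c where c: "x = (\<Sum>b\<in>B. of_int (c b) *\<^sub>R b)" using assms(2) by (rule int_spanE)
  have "representation B x = (\<lambda>b. \<Sum>b'\<in>B. representation B (of_int (c b') *\<^sub>R b') b)"
    unfolding c by (rule real_vector.representation_sum[OF assms(1)]) (auto intro: span_scale span_base)
  also have "\<dots> = (\<lambda>b. \<Sum>b'\<in>B. of_int (c b') * representation B b' b)"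
    using real_vector.representation_scale[OF assms(1) span_base] by (intro ext sum.cong) auto
  finally show ?thesis
    by (auto simp: real_vector.representation_basis[OF assms(1)] intro!: Ints_sum)
qed

section \<open>The bordered logarithmic Hessian\<close>

text \<open>
  The sum of the rank-one matrices \<open>F(m) F(m)\<^sup>T\<close> over the exponents \<open>m\<close>, weighted by the terms
  \<open>c\<^sub>m \<chi>\<^sup>m\<close>. Taking arbitrary functions \<open>F\<^sub>i\<close> lets the change of lattice basis and the translation
  of exponents appear as the same operation, a linear change of \<open>F\<close>.
\<close>

definition moment_matrix ::
  "(nat \<Rightarrow> 'a \<Rightarrow> real) \<Rightarrow> nat \<Rightarrow> 'a::euclidean_space laurent \<Rightarrow> 'a laurent mat" where
  "moment_matrix F n q = Matrix.mat n n (\<lambda>(i, j). weighted (\<lambda>m. of_real (F i m * F j m)) q)"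

lemma moment_matrix_carrier [simp]: "moment_matrix F n q \<in> carrier_mat n n"
  by (simp add: moment_matrix_def)

lemma moment_matrix_dim [simp]: "dim_row (moment_matrix F n q) = n" "dim_col (moment_matrix F n q) = n"
  by (simp_all add: moment_matrix_def)

lemma moment_matrix_index [simp]:
  "i < n \<Longrightarrow> j < n \<Longrightarrow> moment_matrix F n q $$ (i, j) = weighted (\<lambda>m. of_real (F i m * F j m)) q"
  by (simp add: moment_matrix_def)

lemma laurent_ring_0_eq_monom: "q \<in> \<complex>[{0}] \<Longrightarrow> \<exists>c. q = laurent_monom c 0"
  by (intro exI[of _ "laurent_coeff q 0"] laurent_eqI)
     (auto simp: laurent_coeff_monom laurent_ring_def in_laurent_supp_iff subset_eq)

text \<open>
  If \<open>F' = C F\<close>, then the moment matrices are related by \<open>A' = C A C\<^sup>T\<close>, and \<open>(det C)\<^sup>2\<close> is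
  the constant.
\<close>

lemma det_moment_matrix_linear_change:
  assumes C: "\<And>i m. i < n \<Longrightarrow> m \<in> laurent_supp q \<Longrightarrow> F' i m = (\<Sum>j<n. C i j * F j m)"
  shows "\<exists>c. Determinant.det (moment_matrix F' n q) = laurent_monom c 0 * Determinant.det (moment_matrix F n q)"
proof -
  define A :: "'a laurent mat" where "A = Matrix.mat n n (\<lambda>(i, j). laurent_monom (of_real (C i j)) 0)"
  have A: "A \<in> carrier_mat n n" by (simp add: A_def)
  then have AT: "transpose_mat A \<in> carrier_mat n n" by simp
  let ?B = "moment_matrix F n q"
  have eq: "moment_matrix F' n q = A * (?B * transpose_mat A)"
  proof (rule eq_matI)
    fix i j assume "i < dim_row (A * (?B * transpose_mat A))" "j < dim_col (A * (?B * transpose_mat A))"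
    then have ij: "i < n" "j < n" by (simp_all add: A_def)
    have "(A * (?B * transpose_mat A)) $$ (i, j) =
        (\<Sum>k = 0..<n. laurent_monom (of_real (C i k)) 0 * (\<Sum>l = 0..<n.
          weighted (\<lambda>m. of_real (F k m * F l m)) q * laurent_monom (of_real (C j l)) 0))"
      using ij by (simp add: A_def scalar_prod_def)
    moreover have "laurent_coeff \<dots> m = laurent_coeff (weighted (\<lambda>m. of_real (F' i m * F' j m)) q) m" for m
    proof (cases "m \<in> laurent_supp q")
      case True
      have "laurent_coeff (\<Sum>k = 0..<n. laurent_monom (of_real (C i k)) 0 * (\<Sum>l = 0..<n.
          weighted (\<lambda>m. of_real (F k m * F l m)) q * laurent_monom (of_real (C j l)) 0)) m =
          (\<Sum>k = 0..<n. complex_of_real (C i k) * (\<Sum>l = 0..<n. of_real (C j l) * (of_real (F k m * F l m) * laurent_coeff q m)))"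
        by (simp add: laurent_coeff_monom_mult mult.commute[of _ "laurent_monom _ _"])
      also have "\<dots> = of_real ((\<Sum>k = 0..<n. C i k * F k m) * (\<Sum>l = 0..<n. C j l * F l m)) * laurent_coeff q m"
        by (simp add: sum_product sum_distrib_left sum_distrib_right mult_ac, subst sum.swap, simp add: mult_ac)
      also have "\<dots> = laurent_coeff (weighted (\<lambda>m. of_real (F' i m * F' j m)) q) m"
        using C[OF ij(1) True] C[OF ij(2) True] by (simp add: lessThan_atLeast0)
      finally show ?thesis .
    qed (simp add: laurent_coeff_monom_mult mult.commute[of _ "laurent_monom _ _"] in_laurent_supp_iff)
    ultimately show "moment_matrix F' n q $$ (i, j) = (A * (?B * transpose_mat A)) $$ (i, j)"
      using ij by (intro laurent_eqI) (simp only: moment_matrix_index)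
  qed (simp_all add: A_def)
  have "Determinant.det A * Determinant.det A \<in> \<complex>[{0}]"
    by (intro laurent_ring_mult laurent_ring_det[OF _ _ A]) (auto simp: A_def laurent_ring_monom)
  then obtain c where c: "Determinant.det A * Determinant.det A = laurent_monom c 0"
    using laurent_ring_0_eq_monom by blast
  have "Determinant.det (moment_matrix F' n q) = Determinant.det A * (Determinant.det ?B * Determinant.det A)"
    unfolding eq det_mult[OF A mult_carrier_mat[OF moment_matrix_carrier AT]]
      det_mult[OF moment_matrix_carrier AT] det_transpose[OF A] ..
  then have "Determinant.det (moment_matrix F' n q) = laurent_monom c 0 * Determinant.det ?B"
    by (simp add: c[symmetric] mult_ac)
  then show ?thesis by blast
qed

lemma det_moment_matrix_translate:
  "Determinant.det (moment_matrix F n (laurent_monom 1 a * q)) =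
     laurent_monom 1 (of_nat n *\<^sub>R a) * Determinant.det (moment_matrix (\<lambda>i m. F i (a + m)) n q)"
proof -
  have "moment_matrix F n (laurent_monom 1 a * q) =
      laurent_monom 1 a \<cdot>\<^sub>m moment_matrix (\<lambda>i m. F i (a + m)) n q"
    by (rule eq_matI) (simp_all add: weighted_monom_mult)
  then show ?thesis by (simp add: laurent_monom_power)
qed

text \<open>
  The function \<open>case_nat (\<lambda>_. 1) f\<close> is \<open>f\<close> shifted by one index, with the constant \<open>1\<close> put in front; the first
  row and column of the matrix therefore consist of \<open>q\<close> and its logarithmic derivatives.
\<close>

definition bordered_hessian ::
  "(nat \<Rightarrow> 'a \<Rightarrow> real) \<Rightarrow> nat \<Rightarrow> 'a::euclidean_space laurent \<Rightarrow> 'a laurent" where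
  "bordered_hessian f n q = Determinant.det (moment_matrix (case_nat (\<lambda>_. 1) f) (Suc n) q)"

definition basis_coord :: "'a::euclidean_space list \<Rightarrow> nat \<Rightarrow> 'a \<Rightarrow> real" where
  "basis_coord bs i m = representation (set bs) m (bs ! i)"

lemma bordered_hessian_in_ring:
  assumes "\<And>x y. x \<in> L \<Longrightarrow> y \<in> L \<Longrightarrow> x + y \<in> L" "0 \<in> L" "q \<in> \<complex>[L]"
  shows "bordered_hessian f n q \<in> \<complex>[L]"
  unfolding bordered_hessian_def
  using assms by (intro laurent_ring_det[of L _ "Suc n"]) (simp_all add: laurent_ring_weighted)

lemma basis_coord_change:
  assumes bs: "distinct bs" "independent (set bs)" and bs': "independent (set bs')"
    and sp: "span (set bs) = span (set bs')" and m: "m \<in> span (set bs)"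
  shows "basis_coord bs' i m = (\<Sum>j<length bs. basis_coord bs' i (bs ! j) * basis_coord bs j m)"
proof -
  have "basis_coord bs' i m = representation (set bs') (\<Sum>b\<in>set bs. representation (set bs) m b *\<^sub>R b) (bs' ! i)"
    using bs m by (simp add: basis_coord_def real_vector.sum_representation_eq)
  also have "\<dots> = (\<Sum>b\<in>set bs. representation (set bs) m b * representation (set bs') b (bs' ! i))"
  proof -
    have *: "b \<in> span (set bs')" if "b \<in> set bs" for b
      using that sp by (metis span_base)
    show ?thesis
      by (subst real_vector.representation_sum[OF bs'])
         (auto simp: * span_scale real_vector.representation_scale[OF bs' *] intro!: sum.cong)
  qed
  also have "\<dots> = (\<Sum>j<length bs. representation (set bs) m (bs ! j) * representation (set bs') (bs ! j) (bs' ! i))"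
    by (rule sum.reindex_bij_betw[OF bij_betw_nth, symmetric]) (use bs in auto)
  finally show ?thesis by (simp add: basis_coord_def mult.commute)
qed

text \<open>
  In terms of the functions \<open>1, f\<^sub>1, \<dots>, f\<^sub>n\<close>, a change of basis and a translation by \<open>a\<close> form one affine,
  hence linear, change. This contains the independence of the operator \<open>\<mu>\<close> of both choices in its
  definition, up to a constant factor.
\<close>

lemma bordered_hessian_change:
  assumes bs: "distinct bs" "independent (set bs)" and bs': "distinct bs'" "independent (set bs')"
    and sp: "span (set bs) = span (set bs')"
    and q: "laurent_supp q \<subseteq> span (set bs)" and a: "a \<in> span (set bs)"
  shows "\<exists>c. bordered_hessian (basis_coord bs') (length bs') (laurent_monom 1 a * q) =
    laurent_monom c (of_nat (Suc (length bs)) *\<^sub>R a) * bordered_hessian (basis_coord bs) (length bs) q"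
proof -
  have len: "length bs' = length bs"
    using bs bs' sp by (metis dim_span dim_eq_card_independent distinct_card)
  define n where "n = length bs"
  let ?F = "case_nat (\<lambda>_. 1) (basis_coord bs)"
  let ?F' = "\<lambda>i m. case_nat (\<lambda>_. 1) (basis_coord bs') i (a + m)"
  define C where "C i j = (case i of 0 \<Rightarrow> (case j of 0 \<Rightarrow> 1 | Suc l \<Rightarrow> 0)
    | Suc k \<Rightarrow> (case j of 0 \<Rightarrow> basis_coord bs' k a | Suc l \<Rightarrow> basis_coord bs' k (bs ! l)))" for i j
  have "?F' i m = (\<Sum>j<Suc n. C i j * ?F j m)" if "m \<in> laurent_supp q" for i m
  proof (cases i)
    case 0
    then show ?thesis by (simp add: C_def sum.lessThan_Suc_shift del: sum.lessThan_Suc)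
  next
    case (Suc k)
    have m: "m \<in> span (set bs)" using that q by auto
    have "basis_coord bs' k (a + m) = basis_coord bs' k a + basis_coord bs' k m"
      unfolding basis_coord_def using real_vector.representation_add[OF bs'(2)] a m sp by simp
    then show ?thesis
      using basis_coord_change[OF bs bs'(2) sp m, of k] Suc
      by (simp add: C_def sum.lessThan_Suc_shift n_def del: sum.lessThan_Suc)
  qed
  then obtain c where "Determinant.det (moment_matrix ?F' (Suc n) q) =
      laurent_monom c 0 * Determinant.det (moment_matrix ?F (Suc n) q)"
    using det_moment_matrix_linear_change[of "Suc n" q ?F' C ?F] by blast
  then have "bordered_hessian (basis_coord bs') n (laurent_monom 1 a * q) =
      laurent_monom 1 (of_nat (Suc n) *\<^sub>R a) * (laurent_monom c 0 * bordered_hessian (basis_coord bs) n q)"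
    by (simp only: bordered_hessian_def det_moment_matrix_translate)
  then show ?thesis
    by (auto simp: len n_def mult.assoc[symmetric] laurent_monom_mult)
qed

lemma log_deriv_eq_weighted: "log_deriv bs i q = weighted (\<lambda>m. of_real (basis_coord bs i m)) q"
  by (simp add: log_deriv_def weighted_def basis_coord_def)

text \<open>
  Eliminating the first column of the bordered matrix with the pivot \<open>q\<close> leaves
  \<open>D\<^sub>iD\<^sub>jq - D\<^sub>iq D\<^sub>jq / q = q D\<^sub>iD\<^sub>j log q\<close> in the lower right block.
\<close>

lemma bordered_hessian_eq_delta:
  assumes "q \<noteq> 0"
  shows "to_fract (bordered_hessian (basis_coord bs) (length bs) q) =
    to_fract q ^ (length bs + 1) * delta bs q"
proof -
  interpret tf: comm_ring_hom "to_fract :: 'a laurent \<Rightarrow> 'a laurent fract"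
    by unfold_locales simp_all
  define n where "n = length bs"
  let ?Q = "to_fract q" and ?D = "\<lambda>i. to_fract (log_deriv bs i q)"
  let ?B = "map_mat to_fract (moment_matrix (case_nat (\<lambda>_. 1) (basis_coord bs)) (Suc n) q)"
  define X1 where "X1 = four_block_mat (1\<^sub>m 1) (0\<^sub>m 1 n) (Matrix.mat n 1 (\<lambda>(i, j). ?D i / ?Q)) (1\<^sub>m n)"
  define H where "H = Matrix.mat n n (\<lambda>(i, j). DD_log bs i j q)"
  define X2 where "X2 = four_block_mat (Matrix.mat 1 1 (\<lambda>_. ?Q)) (Matrix.mat 1 n (\<lambda>(i, j). ?D j))
      (0\<^sub>m n 1) (?Q \<cdot>\<^sub>m H)"
  have Q: "?Q \<noteq> 0" using assms by simp
  have X: "X1 * X2 = four_block_mat (Matrix.mat 1 1 (\<lambda>_. ?Q)) (Matrix.mat 1 n (\<lambda>(i, j). ?D j))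
      (Matrix.mat n 1 (\<lambda>(i, j). ?D i)) (Matrix.mat n 1 (\<lambda>(i, j). ?D i / ?Q) * Matrix.mat 1 n (\<lambda>(i, j). ?D j) + ?Q \<cdot>\<^sub>m H)"
    unfolding X1_def X2_def
    by (subst mult_four_block_mat[of _ 1 1 _ n _ n _ _ 1 _ n])
       (use Q in \<open>auto simp: H_def scalar_prod_def intro!: cong_four_block_mat eq_matI\<close>)
  have "?B = X1 * X2"
  proof (rule eq_matI)
    fix i j assume "i < dim_row (X1 * X2)" "j < dim_col (X1 * X2)"
    then have ij: "i < Suc n" "j < Suc n" by (simp_all add: X1_def X2_def H_def)
    have DD: "to_fract (log_deriv bs k (log_deriv bs l q)) = ?D k * ?D l / ?Q + ?Q * DD_log bs k l q" for k l
      using Q by (simp add: DD_log_def Fract_conv_to_fract field_simps power2_eq_square)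
    show "?B $$ (i, j) = (X1 * X2) $$ (i, j)"
    proof (cases i)
      case 0
      then show ?thesis using ij unfolding X
        by (cases j) (simp_all add: log_deriv_eq_weighted H_def)
    next
      case (Suc k)
      note i = this
      show ?thesis
      proof (cases j)
        case 0
        then show ?thesis using ij i unfolding X by (simp add: log_deriv_eq_weighted H_def)
      next
        case (Suc l)
        have "?B $$ (i, j) = to_fract (log_deriv bs k (log_deriv bs l q))"
          using ij i Suc by (simp add: log_deriv_eq_weighted weighted_weighted)
        then show ?thesis using ij i Suc unfolding X DD by (simp add: H_def scalar_prod_def)
      qed
    qed
  qed (simp_all add: X1_def X2_def H_def)
  then have "to_fract (bordered_hessian (basis_coord bs) n q) = Determinant.det (X1 * X2)"
    by (simp add: bordered_hessian_def flip: tf.hom_det)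
  also have "\<dots> = Determinant.det X1 * Determinant.det X2"
    by (rule det_mult[of _ "1 + n"]) (unfold X1_def X2_def H_def, auto intro!: four_block_carrier_mat)
  also have "Determinant.det X1 = 1"
    unfolding X1_def by (subst det_four_block_mat_upper_right_zero[of _ 1 _ n]) simp_all
  also have "Determinant.det X2 = ?Q * (?Q ^ n * Determinant.det H)"
    unfolding X2_def
    by (subst det_four_block_mat_lower_left_zero[of _ 1 _ n]) (simp_all add: H_def det_single)
  finally show ?thesis by (simp add: n_def delta_def H_def)
qed

lemma bordered_hessian_cong:
  assumes "\<And>j m. j < n \<Longrightarrow> m \<in> laurent_supp q \<Longrightarrow> f j m = g j m"
  shows "bordered_hessian f n q = bordered_hessian g n q"
proof -
  have "moment_matrix (case_nat (\<lambda>_. 1) f) (Suc n) q = moment_matrix (case_nat (\<lambda>_. 1) g) (Suc n) q"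
    by (rule eq_matI) (auto split: nat.split simp: assms intro!: weighted_cong)
  then show ?thesis by (simp add: bordered_hessian_def)
qed

section \<open>The generalized Einstein condition through the bordered Hessian\<close>

text \<open>
  The supports considered here contain differences that span the ambient lattice over \<open>\<real>\<close>; then \<open>M\<^sub>p\<close> is
  the whole lattice.
\<close>

lemma difference_lattice_eqI:
  assumes "lattice_basis B L" "\<And>b. b \<in> B \<Longrightarrow> \<exists>m\<in>laurent_supp p. \<exists>m'\<in>laurent_supp p. b = m - m'"
  shows "difference_lattice L p = L"
proof -
  have "span B \<subseteq> span {m - m' | m m'. m \<in> laurent_supp p \<and> m' \<in> laurent_supp p}"
    using assms(2) by (intro span_mono) blast
  moreover have "L \<subseteq> span B" using lattice_basis_closed(7)[OF assms(1)] span_superset by blast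
  ultimately show ?thesis by (auto simp: difference_lattice_def)
qed

text \<open>
  By \<open>bordered_hessian_eq_delta\<close>, \<open>\<mu>(p)\<close> is a monomial times the bordered Hessian of \<open>\<chi>\<^sup>-\<^sup>m\<^sup>0 p\<close> in some
  basis. Passing to the basis \<open>bs\<close> and the shift \<open>t\<close> costs a monomial and a constant. The constant may be
  moved into the cofactor in either direction of the equivalence, since each of the two Hessians is a
  constant multiple of the other up to a monomial.
\<close>

lemma GEC_iff_bordered_hessian:
  assumes bs: "distinct bs" "lattice_basis (set bs) L"
    and p: "difference_lattice L p = L" "p \<noteq> 0" "p \<in> \<complex>[L]" and t: "t \<in> L"
  defines "q \<equiv> laurent_monom 1 (- t) * p"
  shows "GEC L p \<longleftrightarrow>
    (\<exists>\<kappa>>0. \<exists>Q\<in>\<complex>[L]. q ^ \<kappa> = bordered_hessian (basis_coord bs) (length bs) q * Q)"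
proof -
  note L = lattice_basis_closed[OF bs(2)]
  define bs0 where "bs0 = (SOME bs. distinct bs \<and> lattice_basis (set bs) (difference_lattice L p))"
  define m0 where "m0 = (SOME m. m \<in> laurent_supp p)"
  have "distinct bs0 \<and> lattice_basis (set bs0) (difference_lattice L p)"
    unfolding bs0_def by (rule someI[of _ bs]) (use bs p in simp)
  then have bs0: "distinct bs0" "lattice_basis (set bs0) L" using p by auto
  obtain m where "m \<in> laurent_supp p" using p(2) laurent_supp_eq_empty_iff by blast
  then have "m0 \<in> laurent_supp p" unfolding m0_def by (rule someI)
  then have m0: "m0 \<in> L" using p(3) by (auto simp: laurent_ring_def)
  have ind: "independent (set bs)" "independent (set bs0)" using bs bs0 by (auto simp: lattice_basis_def)
  have sp: "span (set bs) = span L" "span (set bs0) = span L"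
    using L(7) lattice_basis_closed(7)[OF bs0(2)] by auto
  have len: "length bs0 = length bs"
    using ind bs(1) bs0(1) sp by (metis dim_span dim_eq_card_independent distinct_card)
  let ?n = "length bs"
  let ?h = "\<lambda>bs. bordered_hessian (basis_coord bs) ?n"
  let ?q0 = "laurent_monom 1 (- m0) * p"
  have qL: "q \<in> \<complex>[L]" "?q0 \<in> \<complex>[L]"
    unfolding q_def by (intro laurent_ring_mult[OF L(2)] laurent_ring_monom L(3) t m0 p(3); assumption)+
  have p_q: "p = laurent_monom 1 t * q" "p = laurent_monom 1 m0 * ?q0"
    by (simp_all add: q_def laurent_monom_cancel)
  have q0_q: "?q0 = laurent_monom 1 (t - m0) * q" "q = laurent_monom 1 (m0 - t) * ?q0"
    by (simp_all add: q_def mult.assoc[symmetric] laurent_monom_mult)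
  have q0: "?q0 \<noteq> 0" using p(2) by simp
  have supp: "laurent_supp q \<subseteq> span L" "laurent_supp ?q0 \<subseteq> span L"
    using qL span_superset[of L] by (auto simp: laurent_ring_def)
  have tm: "t - m0 \<in> L" "m0 - t \<in> L" using L(4) t m0 by auto
  then have tm': "t - m0 \<in> span L" "m0 - t \<in> span L" by (auto intro: span_base)
  let ?e = "\<lambda>k a. of_nat k *\<^sub>R a"
  have mu: "mu L p = to_fract (laurent_monom 1 (?e (?n + 1) m0) * ?h bs0 ?q0)"
  proof -
    have "mu L p = to_fract p ^ (?n + 1) * delta bs0 ?q0"
      unfolding mu_def Let_def bs0_def[symmetric] m0_def[symmetric] len ..
    also have "to_fract p ^ (?n + 1) = to_fract (laurent_monom 1 (?e (?n + 1) m0)) * to_fract ?q0 ^ (?n + 1)"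
    proof -
      have pw: "to_fract (x ^ k) = to_fract x ^ k" for x :: "'a laurent" and k by (induction k) simp_all
      show ?thesis
        by (subst p_q(2)) (simp only: to_fract_mult power_mult_distrib pw flip: laurent_monom_power)
    qed
    finally show ?thesis
      using bordered_hessian_eq_delta[OF q0, of bs0] by (simp add: len mult_ac)
  qed
  have pk: "p ^ k = laurent_monom 1 (?e k t) * q ^ k" for k
    by (subst p_q(1)) (simp add: power_mult_distrib laurent_monom_power)
  show ?thesis
  proof
    assume "GEC L p"
    then obtain P \<kappa> Q where P: "to_fract P = mu L p" "\<kappa> > 0" "Q \<in> \<complex>[L]" "p ^ \<kappa> = P * Q"
      unfolding GEC_def by blast
    obtain c where c: "?h bs0 ?q0 = laurent_monom c (?e (Suc ?n) (t - m0)) * ?h bs q"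
      using bordered_hessian_change[OF bs(1) ind(1) bs0(1) ind(2), of q "t - m0"] sp supp tm' q0_q(1) len
      by auto
    let ?Q = "laurent_monom 1 (- ?e \<kappa> t) * (laurent_monom 1 (?e (?n + 1) m0) * (laurent_monom c (?e (Suc ?n) (t - m0)) * Q))"
    have "P = laurent_monom 1 (?e (?n + 1) m0) * ?h bs0 ?q0"
      using P(1) unfolding mu to_fract_eq_iff .
    then have "q ^ \<kappa> = ?h bs q * ?Q"
      using P(4) laurent_monom_cancel(1)[of "?e \<kappa> t" "q ^ \<kappa>"] unfolding pk c by (simp add: mult_ac)
    moreover have "?Q \<in> \<complex>[L]"
      by (intro laurent_ring_mult[OF L(2)] laurent_ring_monom L(3) L(5) tm t m0 P(3); assumption)
    ultimately show "\<exists>\<kappa>>0. \<exists>Q\<in>\<complex>[L]. q ^ \<kappa> = ?h bs q * Q" using P(2) by blast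
  next
    assume "\<exists>\<kappa>>0. \<exists>Q\<in>\<complex>[L]. q ^ \<kappa> = ?h bs q * Q"
    then obtain \<kappa> Q where Q: "\<kappa> > 0" "Q \<in> \<complex>[L]" "q ^ \<kappa> = ?h bs q * Q" by blast
    obtain c where c: "?h bs q = laurent_monom c (?e (Suc ?n) (m0 - t)) * ?h bs0 ?q0"
      using bordered_hessian_change[OF bs0(1) ind(2) bs(1) ind(1), of ?q0 "m0 - t"] sp supp tm' q0_q(2) len
      by auto
    let ?P = "laurent_monom 1 (?e (?n + 1) m0) * ?h bs0 ?q0"
    let ?Q = "laurent_monom 1 (- ?e (?n + 1) m0) * (laurent_monom 1 (?e \<kappa> t) * (laurent_monom c (?e (Suc ?n) (m0 - t)) * Q))"
    have "p ^ \<kappa> = ?P * ?Q"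
      using laurent_monom_cancel(2)[of "?e (?n + 1) m0" "laurent_monom 1 (?e \<kappa> t) * (laurent_monom c (?e (Suc ?n) (m0 - t)) * Q) * ?h bs0 ?q0"]
      unfolding pk Q(3) c by (simp add: mult_ac)
    moreover have "?P \<in> \<complex>[L]"
      by (intro laurent_ring_mult[OF L(2)] laurent_ring_monom bordered_hessian_in_ring[OF L(2,1)] L(5) m0 qL; assumption)
    moreover have "?Q \<in> \<complex>[L]"
      by (intro laurent_ring_mult[OF L(2)] laurent_ring_monom L(3) L(5) tm t m0 Q(2); assumption)
    ultimately show "GEC L p" using Q(1) mu unfolding GEC_def by metis
  qed
qed

section \<open>The lowest part of the bordered Hessian\<close>

lemma prod_list_laurent_monom:
  assumes "\<And>x. x \<in> set xs \<Longrightarrow> \<exists>a. x = laurent_monom 1 a"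
  shows "\<exists>s. prod_list xs = laurent_monom 1 s"
  using assms
proof (induction xs)
  case Nil
  then show ?case using laurent_monom_0_eq_1 by auto
next
  case (Cons x xs)
  then obtain a s where "x = laurent_monom 1 a" "prod_list xs = laurent_monom 1 s" by force
  then show ?case by (auto simp: laurent_monom_mult)
qed

text \<open>
  A polynomial \<open>q\<close> in the variables \<open>y\<^sub>j = \<chi>\<^bsup>b j\<^esup>\<close>, \<open>j < n\<close>, whose coefficients at \<open>1\<close> and at each of
  the \<open>y\<^sub>j\<close> are nonzero; \<open>f j m\<close> is the exponent of \<open>y\<^sub>j\<close> in \<open>\<chi>\<^sup>m\<close>. The functionals \<open>f j\<close> live on the whole
  space, so that the same ones serve for \<open>q\<close> and for its restrictions to coordinate subspaces.
\<close>

locale nonneg_coordinates =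
  fixes f :: "nat \<Rightarrow> 'a::euclidean_space \<Rightarrow> real" and b :: "nat \<Rightarrow> 'a" and n :: nat and q :: "'a laurent"
  assumes linear_coord: "\<And>j. j < n \<Longrightarrow> linear (f j)"
    and dual: "\<And>i j. i < n \<Longrightarrow> j < n \<Longrightarrow> f i (b j) = (if i = j then 1 else 0)"
    and coord_Nats: "\<And>m j. m \<in> laurent_supp q \<Longrightarrow> j < n \<Longrightarrow> f j m \<in> \<nat>"
    and zero_in_supp: "0 \<in> laurent_supp q"
    and basis_in_supp: "\<And>j. j < n \<Longrightarrow> b j \<in> laurent_supp q"
begin

text \<open>
  The total degree in the variables \<open>y\<^sub>r, \<dots>, y\<^sub>n\<^sub>-\<^sub>1\<close>. On the support of \<open>q\<close> it vanishes exactly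
  when none of these variables occurs, so truncation to height \<open>0\<close> sets them to zero.
\<close>

definition height :: "nat \<Rightarrow> 'a \<Rightarrow> real" where
  "height r m = (\<Sum>j = r..<n. f j m)"

lemma linear_height: "linear (height r)"
  unfolding height_def by (intro linear_compose_sum ballI linear_coord) simp

lemma coord_nonneg: "m \<in> laurent_supp q \<Longrightarrow> j < n \<Longrightarrow> 0 \<le> f j m"
  using coord_Nats[of m j] by (auto simp: Nats_def)

lemma coord_ge_1: "m \<in> laurent_supp q \<Longrightarrow> j < n \<Longrightarrow> f j m \<noteq> 0 \<Longrightarrow> 1 \<le> f j m"
  using coord_Nats[of m j] by (auto simp: Nats_def)

lemma height_nonneg: "m \<in> laurent_supp q \<Longrightarrow> 0 \<le> height r m"
  unfolding height_def by (intro sum_nonneg coord_nonneg) auto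

lemma height_ge_coords:
  assumes "m \<in> laurent_supp q" "A \<subseteq> {r..<n}"
  shows "(\<Sum>j\<in>A. f j m) \<le> height r m"
  unfolding height_def using assms by (intro sum_mono2) (auto intro: coord_nonneg)

lemma height_basis: "k < n \<Longrightarrow> height r (b k) = (if r \<le> k then 1 else 0)"
proof -
  assume "k < n"
  then have "height r (b k) = (\<Sum>j = r..<n. if j = k then 1 else 0)"
    unfolding height_def by (intro sum.cong) (auto simp: dual)
  then show ?thesis using \<open>k < n\<close> by simp
qed

text \<open>
  Row \<open>k + 1\<close> of the bordered matrix only involves monomials divisible by \<open>y\<^sub>k\<close>. Dividing it by \<open>y\<^sub>k\<close>
  for all \<open>k \<ge> r\<close> and then setting \<open>y\<^sub>r, \<dots>, y\<^sub>n\<^sub>-\<^sub>1\<close> to zero leaves in column \<open>l + 1\<close>, \<open>l \<ge> r\<close>, only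
  the diagonal entry: a surviving monomial off the diagonal would have to be divisible by \<open>y\<^sub>k y\<^sub>l\<close>, or
  by \<open>y\<^sub>l\<close> in a row that has not been divided. The diagonal entry in row \<open>k + 1\<close> has the coefficient of
  \<open>q\<close> at \<open>y\<^sub>k\<close> as constant term. So the matrix is block triangular, and \<open>g\<close> is the product of these
  diagonal entries.
\<close>

lemma bordered_hessian_lowest_part:
  assumes r: "r \<le> n"
  shows "\<exists>s D g. bordered_hessian f n q = laurent_monom 1 s * D \<and> D \<in> \<complex>[{m. 0 \<le> height r m}] \<and> g \<noteq> 0 \<and>
    restrict_supp {m. height r m = 0} D =
      bordered_hessian f r (restrict_supp {m. height r m = 0} q) * g"
proof -
  let ?u = "height r" and ?F = "case_nat (\<lambda>_. 1) f"
  let ?X = "{m. height r m = 0}"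
  let ?\<rho> = "restrict_supp ?X"
  let ?w = "\<lambda>i j. weighted (\<lambda>m. complex_of_real (?F i m * ?F j m)) q"
  let ?B = "moment_matrix ?F (Suc n) q"
  \<comment> \<open>Row \<open>i = k + 1\<close> belongs to the variable \<open>y\<^sub>k\<close>; row \<open>0\<close> is the border.\<close>
  define s where "s i = (if i \<le> r then 0 else b (i - 1))" for i
  define R where "R = Matrix.mat (Suc n) (Suc n) (\<lambda>(i, j). laurent_monom 1 (- s i) * ?w i j)"
  have R: "R \<in> carrier_mat (Suc n) (Suc n)" by (simp add: R_def)
  let ?\<Delta> = "mat_diag (Suc n) (\<lambda>i. laurent_monom 1 (s i))"
  have "?B = ?\<Delta> * R"
    by (subst mat_diag_mult_left[OF R]) (auto simp: R_def laurent_monom_cancel intro!: eq_matI)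
  then have "bordered_hessian f n q = Determinant.det ?\<Delta> * Determinant.det R"
    unfolding bordered_hessian_def by (simp add: det_mult[OF _ R])
  moreover have "\<exists>t. Determinant.det ?\<Delta> = laurent_monom 1 t"
  proof -
    have "Determinant.det ?\<Delta> = prod_list (map (\<lambda>i. laurent_monom 1 (s i)) [0..<Suc n])"
      by (subst det_upper_triangular[of _ "Suc n"])
         (auto simp: mat_diag_def upper_triangular_def diag_mat_def simp del: upt_Suc
           intro!: arg_cong[of _ _ prod_list] map_cong)
    then show ?thesis by (auto simp del: upt_Suc intro!: prod_list_laurent_monom)
  qed
  ultimately obtain t where t: "bordered_hessian f n q = laurent_monom 1 t * Determinant.det R" by auto

  have R_supp: "m + s i \<in> laurent_supp q \<and> ?F i (m + s i) \<noteq> 0 \<and> ?F j (m + s i) \<noteq> 0"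
    if "m \<in> laurent_supp (laurent_monom 1 (- s i) * ?w i j)" for m i j
    using that by (auto simp: laurent_supp_monom_mult laurent_supp_weighted)
  have u_s: "?u (m + s i) = ?u m + (if i \<le> r then 0 else 1)" if "i < Suc n" for i m
    using that height_basis[of "i - 1" r] linear_add[OF linear_height] linear_0[OF linear_height]
    by (auto simp: s_def)
  have R_nonneg: "R $$ (i, j) \<in> \<complex>[{m. 0 \<le> ?u m}]" if ij: "i < Suc n" "j < Suc n" for i j
  proof -
    have "0 \<le> ?u m" if m: "m \<in> laurent_supp (laurent_monom 1 (- s i) * ?w i j)" for m
    proof (cases "i \<le> r")
      case True
      then show ?thesis using R_supp[OF m] height_nonneg[of "m + s i" r] u_s[OF ij(1), of m] by simp
    next
      case False
      then obtain k where k: "i = Suc k" "r \<le> k" "k < n" using ij by (cases i) auto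
      then have "1 \<le> f k (m + s i)" using R_supp[OF m] by (intro coord_ge_1) auto
      also have "\<dots> \<le> ?u (m + s i)"
        using height_ge_coords[of "m + s i" "{k}" r] R_supp[OF m] k by auto
      finally show ?thesis using u_s[OF ij(1), of m] False by simp
    qed
    then show ?thesis using ij by (auto simp: R_def laurent_ring_def)
  qed
  have D_nonneg: "Determinant.det R \<in> \<complex>[{m. 0 \<le> ?u m}]"
    by (rule laurent_ring_det[OF nonneg_closed[OF linear_height] R R_nonneg])

  have R_zero: "?\<rho> (R $$ (i, j)) = 0" if ij: "i < Suc n" "r < j" "j < Suc n" "i \<noteq> j" for i j
  proof -
    obtain l where l: "j = Suc l" "r \<le> l" "l < n" using ij by (cases j) auto
    have "?u m \<noteq> 0" if m: "m \<in> laurent_supp (laurent_monom 1 (- s i) * ?w i j)" for m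
    proof -
      note m' = R_supp[OF m]
      have fl: "1 \<le> f l (m + s i)" using m' l by (intro coord_ge_1) auto
      show ?thesis
      proof (cases "i \<le> r")
        case True
        then show ?thesis
          using fl height_ge_coords[of "m + s i" "{l}" r] m' l u_s[OF ij(1), of m] by auto
      next
        case False
        then obtain k where k: "i = Suc k" "r \<le> k" "k < n" using ij by (cases i) auto
        have "1 \<le> f k (m + s i)" using m' k by (intro coord_ge_1) auto
        moreover have "k \<noteq> l" using ij k l by auto
        ultimately show ?thesis
          using fl height_ge_coords[of "m + s i" "{k, l}" r] m' k l u_s[OF ij(1), of m] by auto
      qed
    qed
    then show ?thesis using ij by (intro restrict_supp_zero) (auto simp: R_def)
  qed
  let ?C = "map_mat ?\<rho> R"
  let ?A1 = "moment_matrix ?F (Suc r) (?\<rho> q)"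
  let ?A3 = "Matrix.mat (n - r) (Suc r) (\<lambda>(i, j). ?C $$ (i + Suc r, j))"
  let ?A4 = "Matrix.mat (n - r) (n - r) (\<lambda>(i, j). ?C $$ (i + Suc r, j + Suc r))"
  have C: "?C = four_block_mat ?A1 (0\<^sub>m (Suc r) (n - r)) ?A3 ?A4"
  proof (rule eq_matI)
    fix i j assume "i < dim_row (four_block_mat ?A1 (0\<^sub>m (Suc r) (n - r)) ?A3 ?A4)"
      "j < dim_col (four_block_mat ?A1 (0\<^sub>m (Suc r) (n - r)) ?A3 ?A4)"
    then have ij: "i < Suc n" "j < Suc n" using r by auto
    have "?\<rho> (R $$ (i, j)) = weighted (\<lambda>m. complex_of_real (?F i m * ?F j m)) (?\<rho> q)" if "i \<le> r"
      using ij that by (simp add: R_def s_def laurent_monom_0_eq_1 weighted_weighted mult.commute)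
    then show "?C $$ (i, j) = four_block_mat ?A1 (0\<^sub>m (Suc r) (n - r)) ?A3 ?A4 $$ (i, j)"
      using ij r R R_zero[of i j] by auto
  qed (use r R in auto)
  have "Determinant.det (four_block_mat ?A1 (0\<^sub>m (Suc r) (n - r)) ?A3 ?A4) =
      bordered_hessian f r (?\<rho> q) * Determinant.det ?A4"
    unfolding bordered_hessian_def
    by (rule det_four_block_mat_upper_right_zero[of _ "Suc r" _ "n - r"]) auto
  then have "Determinant.det ?C = bordered_hessian f r (?\<rho> q) * Determinant.det ?A4"
    by (rule trans[OF arg_cong[OF C]])
  moreover have "?\<rho> (Determinant.det R) = Determinant.det ?C"
    by (rule restrict_supp_det_nonneg[OF linear_height R R_nonneg])
  moreover have "Determinant.det ?A4 \<noteq> 0"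
  proof -
    have "?A4 $$ (i, i) \<noteq> 0" if i: "i < n - r" for i
    proof -
      let ?i = "Suc (i + r)"
      have "s ?i = b (i + r)" by (simp add: s_def)
      then have "laurent_coeff (R $$ (?i, ?i)) 0 = laurent_coeff q (b (i + r))"
        using i dual[of "i + r" "i + r"] by (simp add: R_def laurent_coeff_monom_mult)
      moreover have "laurent_coeff q (b (i + r)) \<noteq> 0"
        using basis_in_supp[of "i + r"] i by (simp add: in_laurent_supp_iff)
      ultimately have "laurent_coeff (?\<rho> (R $$ (?i, ?i))) 0 \<noteq> 0"
        by (simp add: linear_0[OF linear_height])
      then have "?\<rho> (R $$ (?i, ?i)) \<noteq> 0" by (metis laurent_coeff_0)
      then show ?thesis using i R by simp
    qed
    moreover have "upper_triangular ?A4"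
      using R_zero R by (auto simp: upper_triangular_def)
    ultimately show ?thesis
      by (subst det_upper_triangular[of _ "n - r"]) (auto simp: prod_list_zero_iff diag_mat_def)
  qed
  ultimately show ?thesis using t D_nonneg by metis
qed

text \<open>
  Setting all variables to zero (\<open>r = 0\<close>), the remaining block is the constant term of \<open>q\<close>.
\<close>

lemma bordered_hessian_nonzero: "bordered_hessian f n q \<noteq> 0"
proof -
  let ?q = "restrict_supp {m. height 0 m = 0} q"
  obtain s D g where D: "bordered_hessian f n q = laurent_monom 1 s * D" "g \<noteq> 0"
      "restrict_supp {m. height 0 m = 0} D = bordered_hessian f 0 ?q * g"
    using bordered_hessian_lowest_part[of 0] by auto
  have "bordered_hessian f 0 ?q = ?q"
    unfolding bordered_hessian_def by (simp add: det_single)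
  moreover have "0 \<in> laurent_supp ?q"
    using zero_in_supp by (simp add: laurent_supp_restrict linear_0[OF linear_height])
  then have "?q \<noteq> 0" by auto
  ultimately have "D \<noteq> 0" using D by (auto simp: weighted_def)
  then show ?thesis using D(1) by simp
qed

lemma restrict_nonneg_coordinates:
  assumes "r \<le> n"
  shows "nonneg_coordinates f b r (restrict_supp {m. height r m = 0} q)"
proof (rule nonneg_coordinates.intro)
  show "linear (f j)" if "j < r" for j using that assms by (intro linear_coord) simp
qed (use assms dual coord_Nats zero_in_supp basis_in_supp
    in \<open>auto simp: laurent_supp_restrict linear_0[OF linear_height] height_basis\<close>)

text \<open>
  After moving the monomial factor of the Hessian into the cofactor, both \<open>q\<^sup>\<kappa>\<close> and the other factor have
  nonnegative height and nonzero part of height \<open>0\<close>. Hence the cofactor has nonnegative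
  height as well, and the homomorphism setting \<open>y\<^sub>r, \<dots>, y\<^sub>n\<^sub>-\<^sub>1\<close> to zero may be applied to the
  identity.
\<close>

lemma bordered_hessian_dvd_power_restrict:
  assumes r: "r \<le> n" and dvd: "q ^ \<kappa> = bordered_hessian f n q * Q"
  defines "q\<^sub>r \<equiv> restrict_supp {m. height r m = 0} q"
  shows "\<exists>Q. q\<^sub>r ^ \<kappa> = bordered_hessian f r q\<^sub>r * Q"
proof -
  let ?\<rho> = "restrict_supp {m. height r m = 0}" and ?A = "\<complex>[{m. 0 \<le> height r m}]"
  note lin = linear_height[of r]
  obtain s D g where D: "bordered_hessian f n q = laurent_monom 1 s * D" "D \<in> ?A" "g \<noteq> 0"
      "?\<rho> D = bordered_hessian f r q\<^sub>r * g"
    using bordered_hessian_lowest_part[OF r] unfolding q\<^sub>r_def by auto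
  have "bordered_hessian f r q\<^sub>r \<noteq> 0"
    unfolding q\<^sub>r_def
    by (rule nonneg_coordinates.bordered_hessian_nonzero[OF restrict_nonneg_coordinates[OF r]])
  then have D0: "?\<rho> D \<noteq> 0" using D by simp
  let ?Q = "laurent_monom 1 s * Q"
  have qA: "q \<in> ?A" using height_nonneg by (auto simp: laurent_ring_def)
  have eq: "q ^ \<kappa> = D * ?Q" using dvd D(1) by (simp add: mult_ac)
  have "q ^ \<kappa> \<in> ?A" by (rule laurent_ring_power[OF nonneg_closed[OF lin] qA])
  then have "?Q \<in> ?A"
    using supp_cofactor_nonneg[OF lin _ D0, of ?Q] D(2) by (simp add: laurent_ring_def eq)
  then have "?\<rho> (q ^ \<kappa>) = ?\<rho> D * ?\<rho> ?Q"
    unfolding eq by (rule restrict_supp_mult_nonneg[OF lin D(2)])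
  then have "q\<^sub>r ^ \<kappa> = bordered_hessian f r q\<^sub>r * (g * ?\<rho> ?Q)"
    using restrict_supp_power_nonneg[OF lin qA] D(4) by (simp add: q\<^sub>r_def mult_ac)
  then show ?thesis by blast
qed

end

section \<open>Edge cones of polytopes\<close>

lemma vertex_exposed:
  fixes S :: "'a::euclidean_space set"
  assumes S: "finite S" and v: "v extreme_point_of (convex hull S)"
  obtains a where "\<And>x. x \<in> convex hull S \<Longrightarrow> x \<noteq> v \<Longrightarrow> a \<bullet> v < a \<bullet> x"
proof -
  have "{v} exposed_face_of (convex hull S)"
    using v S by (simp add: exposed_face_of_polyhedron polyhedron_convex_hull face_of_singleton)
  then obtain a b where ab: "convex hull S \<subseteq> {x. a \<bullet> x \<le> b}" "{v} = convex hull S \<inter> {x. a \<bullet> x = b}"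
    unfolding exposed_face_of_def by auto
  have "(- a) \<bullet> v < (- a) \<bullet> x" if x: "x \<in> convex hull S" "x \<noteq> v" for x
  proof -
    have "a \<bullet> v = b" "a \<bullet> x \<le> b" using ab x by blast+
    moreover have "a \<bullet> x \<noteq> b" using ab x by blast
    ultimately show ?thesis by simp
  qed
  then show thesis by (rule that)
qed

text \<open>
  An edge is collinear and cannot extend to both sides of one of its vertices.
\<close>

lemma edge_points_same_ray:
  fixes P :: "'a::euclidean_space set"
  assumes E: "E edge_of P" "v \<in> E" and v: "v extreme_point_of P"
    and x: "x \<in> E" "x \<noteq> v" and y: "y \<in> E" "y \<noteq> v"
  obtains c where "c > 0" "y - v = c *\<^sub>R (x - v)"
proof -
  have "collinear E" using E(1) by (simp add: edge_of_def collinear_aff_dim)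
  then obtain u where u: "\<And>x y. x \<in> E \<Longrightarrow> y \<in> E \<Longrightarrow> \<exists>c. x - y = c *\<^sub>R u"
    unfolding collinear_def by blast
  obtain r s where r: "x - v = r *\<^sub>R u" and s: "y - v = s *\<^sub>R u" using u[OF x(1) E(2)] u[OF y(1) E(2)] by blast
  have r0: "r \<noteq> 0" "s \<noteq> 0" using r s x(2) y(2) by auto
  define c where "c = s / r"
  have c: "y - v = c *\<^sub>R (x - v)" using r s r0 by (simp add: c_def)
  have "c > 0"
  proof (rule ccontr)
    assume "\<not> c > 0"
    moreover have "c \<noteq> 0" using r0 by (simp add: c_def)
    ultimately have neg: "c < 0" by linarith
    \<comment> \<open>The weight that expresses \<open>v\<close> as a convex combination of \<open>x\<close> and \<open>y\<close> on opposite sides of it.\<close>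
    define t where "t = - c / (1 - c)"
    have t: "0 < t" "t < 1" using neg by (auto simp: t_def field_simps)
    have y': "y = v + c *\<^sub>R (x - v)" using c by (simp add: algebra_simps)
    have "(1 - t) *\<^sub>R y + t *\<^sub>R x = v + ((1 - t) * c + t) *\<^sub>R (x - v)"
      unfolding y' by (simp add: algebra_simps)
    also have "(1 - t) * c + t = 0" using neg by (simp add: t_def field_simps)
    finally have "v = (1 - t) *\<^sub>R y + t *\<^sub>R x" by simp
    moreover have "y \<noteq> x" using c neg x(2) by (metis diff_self eq_iff_diff_eq_0 less_numeral_extra(1) not_less_iff_gr_or_eq scaleR_cancel_right scaleR_one)
    ultimately have "v \<in> open_segment y x" using t unfolding in_segment by blast
    moreover have "x \<in> P" "y \<in> P" using x y E edge_of_imp_subset by blast+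
    ultimately show False using v unfolding extreme_point_of_def by blast
  qed
  then show thesis using c by (rule that)
qed

text \<open>
  Let \<open>a\<close> attain its minimum over the polytope only at \<open>v\<close>. The directions \<open>s - v\<close>, rescaled to
  satisfy \<open>a \<bullet> x = 1\<close>, form a finite set \<open>T\<close> (the vertex figure), and it suffices to see that each extreme
  point \<open>t\<close> of its convex hull is the direction of an edge. If \<open>b\<close> exposes \<open>t\<close>, then \<open>g = b - (b \<bullet> t) a\<close> is
  nonnegative on all \<open>s - v\<close> and vanishes exactly in direction \<open>t\<close>; so it supports the polytope
  along an edge.
\<close>

lemma convex_hull_subset_edge_cone:
  fixes S :: "'a::euclidean_space set"
  assumes S: "finite S" and v: "v extreme_point_of (convex hull S)"
    and w: "\<And>E. E \<in> edges_at (convex hull S) v \<Longrightarrow> w E \<in> E \<and> w E \<noteq> v"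
    and x: "x \<in> convex hull S"
  shows "x - v \<in> convex_cone hull ((\<lambda>E. w E - v) ` edges_at (convex hull S) v)"
proof -
  let ?P = "convex hull S" and ?K = "convex_cone hull ((\<lambda>E. w E - v) ` edges_at (convex hull S) v)"
  obtain a where a: "\<And>x. x \<in> ?P \<Longrightarrow> x \<noteq> v \<Longrightarrow> a \<bullet> v < a \<bullet> x"
    using vertex_exposed[OF S v] by blast
  have SP: "S \<subseteq> ?P" by (rule hull_subset)
  have vP: "v \<in> ?P" "v \<in> S" using v extreme_point_of_convex_hull by (auto simp: extreme_point_of_def)
  define \<tau> where "\<tau> s = (1 / (a \<bullet> (s - v))) *\<^sub>R (s - v)" for s
  have apos: "a \<bullet> (s - v) > 0" if "s \<in> S" "s \<noteq> v" for s
    using a[of s] that SP by (auto simp: inner_diff_right)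
  have \<tau>: "s - v = (a \<bullet> (s - v)) *\<^sub>R \<tau> s" "a \<bullet> \<tau> s = 1" if "s \<in> S" "s \<noteq> v" for s
    using apos[OF that] by (auto simp: \<tau>_def)
  define T where "T = \<tau> ` (S - {v})"
  have finT: "finite T" using S by (simp add: T_def)
  have ext: "t \<in> ?K" if t: "t extreme_point_of (convex hull T)" for t
  proof -
    have tT: "t \<in> T" using t by (rule extreme_point_of_convex_hull)
    then obtain s0 where s0: "s0 \<in> S" "s0 \<noteq> v" "t = \<tau> s0" by (auto simp: T_def)
    obtain b where b: "\<And>x. x \<in> convex hull T \<Longrightarrow> x \<noteq> t \<Longrightarrow> b \<bullet> t < b \<bullet> x"
      using vertex_exposed[OF finT t] by blast
    define g where "g = b - (b \<bullet> t) *\<^sub>R a"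
    have g: "g \<bullet> (s - v) = (a \<bullet> (s - v)) * (b \<bullet> \<tau> s - b \<bullet> t)" if "s \<in> S" "s \<noteq> v" for s
    proof -
      have "g \<bullet> (s - v) = (a \<bullet> (s - v)) * (g \<bullet> \<tau> s)" by (subst \<tau>(1)[OF that]) simp
      also have "g \<bullet> \<tau> s = b \<bullet> \<tau> s - b \<bullet> t" using \<tau>(2)[OF that] by (simp add: g_def inner_diff_left)
      finally show ?thesis .
    qed
    have g_nonneg: "g \<bullet> (s - v) \<ge> 0" and g_zero: "g \<bullet> (s - v) = 0 \<Longrightarrow> s = v \<or> \<tau> s = t" if "s \<in> S" for s
    proof -
      have "b \<bullet> t \<le> b \<bullet> \<tau> s" "\<tau> s \<noteq> t \<Longrightarrow> b \<bullet> t < b \<bullet> \<tau> s" if "s \<noteq> v"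
      proof -
        have "\<tau> s \<in> convex hull T" using \<open>s \<in> S\<close> that by (auto simp: T_def intro: hull_inc)
        then show "\<tau> s \<noteq> t \<Longrightarrow> b \<bullet> t < b \<bullet> \<tau> s" by (rule b)
        then show "b \<bullet> t \<le> b \<bullet> \<tau> s" by (cases "\<tau> s = t") auto
      qed
      then show "g \<bullet> (s - v) \<ge> 0" "g \<bullet> (s - v) = 0 \<Longrightarrow> s = v \<or> \<tau> s = t"
        using g[OF \<open>s \<in> S\<close>] apos[OF \<open>s \<in> S\<close>] by (cases "s = v"; force)+
    qed
    define E where "E = ?P \<inter> {x. g \<bullet> x = g \<bullet> v}"
    have "?P \<subseteq> {x. g \<bullet> x \<ge> g \<bullet> v}"
      by (rule hull_minimal) (use g_nonneg in \<open>auto simp: inner_diff_right convex_halfspace_ge\<close>)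
    then have E_face: "E face_of ?P"
      unfolding E_def by (intro face_of_Int_supporting_hyperplane_ge) auto
    obtain S' where S': "S' \<subseteq> S" "E = convex hull S'"
      using face_of_convex_hull_subset[OF finite_imp_compact[OF S] E_face] .
    have vE: "v \<in> E" using vP by (simp add: E_def)
    have "g \<bullet> (s0 - v) = 0" using g[OF s0(1,2)] s0(3) by simp
    then have s0E: "s0 \<in> E" using s0 SP by (auto simp: E_def inner_diff_right)
    have "S' \<subseteq> affine hull {v, v + t}"
    proof
      fix s assume s: "s \<in> S'"
      then have "s \<in> E" unfolding S'(2) by (rule hull_inc)
      then have "g \<bullet> (s - v) = 0" by (simp add: E_def inner_diff_right)
      then have "s = v \<or> \<tau> s = t" using g_zero s S'(1) by (meson subsetD)
      then obtain k where "s - v = k *\<^sub>R t" using \<tau>(1)[of s] s S'(1) by (metis diff_self scaleR_zero_left subsetD)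
      then have "s = (1 - k) *\<^sub>R v + k *\<^sub>R (v + t)" by (simp add: algebra_simps)
      then show "s \<in> affine hull {v, v + t}"
        unfolding affine_hull_2 by (intro CollectI exI[of _ "1 - k"] exI[of _ k] conjI) simp_all
    qed
    then have "E \<subseteq> affine hull {v, v + t}"
      unfolding S'(2) by (simp add: hull_minimal affine_imp_convex)
    then have "collinear E" by (auto simp: collinear_affine_hull)
    moreover have "\<not> aff_dim E \<le> 0"
    proof
      assume "aff_dim E \<le> 0"
      moreover have "aff_dim E \<noteq> -1" using vE aff_dim_empty[of E] by auto
      ultimately have "aff_dim E = 0" using aff_dim_geq[of E] by linarith
      then obtain z where "E = {z}" by (auto simp: aff_dim_eq_0)
      then show False using vE s0E s0(2) by auto
    qed
    ultimately have "E edge_of ?P" using E_face by (simp add: edge_of_def collinear_aff_dim)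
    then have E: "E \<in> edges_at ?P v" using vE by (simp add: edges_at_def)
    obtain c where c: "c > 0" "s0 - v = c *\<^sub>R (w E - v)"
      using edge_points_same_ray[OF \<open>E edge_of ?P\<close> vE v, of "w E" s0] w[OF E] s0E s0(2) by blast
    have "w E - v \<in> ?K" by (rule hull_inc) (use E in auto)
    then have "(c / (a \<bullet> (s0 - v))) *\<^sub>R (w E - v) \<in> ?K"
      using c(1) apos[OF s0(1,2)] by (intro convex_cone_hull_mul) auto
    moreover have "t = (c / (a \<bullet> (s0 - v))) *\<^sub>R (w E - v)"
      unfolding s0(3) \<tau>_def c(2) by simp
    ultimately show ?thesis by simp
  qed
  have "convex hull T \<subseteq> ?K"
    using Krein_Milman_polytope[OF finT] ext hull_minimal[of "{x. x extreme_point_of convex hull T}" ?K convex]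
    by (auto simp: convex_convex_cone_hull)
  then have TK: "T \<subseteq> ?K" using hull_subset[of T convex] by blast
  have SK: "s - v \<in> ?K" if "s \<in> S" for s
  proof (cases "s = v")
    case False
    then have "\<tau> s \<in> ?K" using TK that by (auto simp: T_def)
    then have "(a \<bullet> (s - v)) *\<^sub>R \<tau> s \<in> ?K" using apos[OF that False] by (intro convex_cone_hull_mul) auto
    then show ?thesis using \<tau>(1)[OF that False] by simp
  qed (simp add: convex_cone_hull_contains_0)
  have "S \<subseteq> (+) v ` ?K"
  proof
    fix s assume "s \<in> S"
    then show "s \<in> (+) v ` ?K" using SK by (auto intro!: image_eqI[of _ _ "s - v"])
  qed
  then have "?P \<subseteq> (+) v ` ?K"
    by (rule hull_minimal) (simp add: convex_translation convex_convex_cone_hull)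
  then show ?thesis using x by auto
qed

lemma convex_cone_hull_nonneg:
  assumes "linear f" "\<And>x. x \<in> B \<Longrightarrow> 0 \<le> f x" "x \<in> convex_cone hull B"
  shows "0 \<le> (f x :: real)"
proof -
  have "convex_cone {x. 0 \<le> f x}"
    using assms(1) by (auto simp: convex_cone_iff linear_add linear_0 linear_scale)
  then have "convex_cone hull B \<subseteq> {x. 0 \<le> f x}"
    using assms(2) by (intro hull_minimal) auto
  then show ?thesis using assms(3) by auto
qed

section \<open>Faces dual to cones of the normal fan\<close>

text \<open>
  All \<open>u \<in> \<sigma>\<close> are minimal on \<open>P\<close> at a common point, hence the set where all of them are minimal is an
  intersection of faces. Enlarging the face \<open>F\<close> that defines \<open>\<sigma>\<close> to this set
  does not change the cone: more points give more inequalities, but every \<open>u \<in> \<sigma>\<close> satisfies the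
  additional ones by construction.
\<close>

lemma cone_face_normal_fan:
  assumes P: "convex P" and \<sigma>: "\<sigma> \<in> normal_fan P"
  shows "cone_face P \<sigma> face_of P" "cone_face P \<sigma> \<noteq> {}" "\<sigma> = face_cone P (cone_face P \<sigma>)"
proof -
  obtain F where F: "\<sigma> = face_cone P F" "F face_of P" "F \<noteq> {}"
    using \<sigma> by (auto simp: normal_fan_def)
  have FG: "F \<subseteq> cone_face P \<sigma>"
    using face_of_imp_subset[OF F(2)] by (auto simp: F(1) cone_face_def face_cone_def)
  then show "cone_face P \<sigma> \<noteq> {}" using F(3) by blast
  show "\<sigma> = face_cone P (cone_face P \<sigma>)"
  proof
    show "\<sigma> \<subseteq> face_cone P (cone_face P \<sigma>)" by (auto simp: face_cone_def cone_face_def)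
    show "face_cone P (cone_face P \<sigma>) \<subseteq> \<sigma>" using FG by (auto simp: F(1) face_cone_def)
  qed
  obtain y0 where y0: "y0 \<in> P" "\<And>u x. u \<in> \<sigma> \<Longrightarrow> x \<in> P \<Longrightarrow> u \<bullet> y0 \<le> u \<bullet> x"
    using FG F(3) by (auto simp: cone_face_def inner_diff_right)
  have "cone_face P \<sigma> = (\<Inter>u\<in>\<sigma>. P \<inter> {x. u \<bullet> x = u \<bullet> y0})"
  proof
    have "u \<bullet> y = u \<bullet> y0" if "y \<in> cone_face P \<sigma>" "u \<in> \<sigma>" for u y
      using y0(2)[OF that(2), of y] y0(1) that by (simp add: cone_face_def inner_diff_right antisym)
    then show "cone_face P \<sigma> \<subseteq> (\<Inter>u\<in>\<sigma>. P \<inter> {x. u \<bullet> x = u \<bullet> y0})"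
      by (auto simp: cone_face_def)
    have "0 \<in> \<sigma>" by (simp add: F(1) face_cone_def)
    then show "(\<Inter>u\<in>\<sigma>. P \<inter> {x. u \<bullet> x = u \<bullet> y0}) \<subseteq> cone_face P \<sigma>"
      using y0(2) by (auto simp: cone_face_def inner_diff_right)
  qed
  also have "\<dots> face_of P"
  proof (rule face_of_Inter)
    have "0 \<in> \<sigma>" by (simp add: F(1) face_cone_def)
    then show "(\<lambda>u. P \<inter> {x. u \<bullet> x = u \<bullet> y0}) ` \<sigma> \<noteq> {}" by auto
  qed (use y0(2) P in \<open>auto intro!: face_of_Int_supporting_hyperplane_ge\<close>)
  finally show "cone_face P \<sigma> face_of P" .
qed

lemma inner_eq_on_cone_face:
  assumes "u \<in> \<sigma>" "x \<in> cone_face P \<sigma>" "y \<in> cone_face P \<sigma>"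
  shows "u \<bullet> x = u \<bullet> y"
proof (rule antisym)
  show "u \<bullet> x \<le> u \<bullet> y" "u \<bullet> y \<le> u \<bullet> x"
    using assms by (simp_all add: cone_face_def inner_diff_right)
qed

lemma mem_orthogonal_comp_iff: "x \<in> orthogonal_comp \<sigma> \<longleftrightarrow> (\<forall>u\<in>\<sigma>. u \<bullet> x = 0)"
  by (simp add: orthogonal_comp_def real_inner_class.orthogonal_def)

lemma diff_in_orthogonal_comp:
  assumes "x \<in> cone_face P \<sigma>" "y \<in> cone_face P \<sigma>"
  shows "x - y \<in> orthogonal_comp \<sigma>"
proof -
  have "u \<bullet> (x - y) = 0" if "u \<in> \<sigma>" for u
    using inner_eq_on_cone_face[OF that assms] by (simp add: inner_diff_right)
  then show ?thesis by (simp add: mem_orthogonal_comp_iff)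
qed

lemma face_of_convex_hull_eq:
  fixes S :: "'a::euclidean_space set"
  assumes "finite S" "G face_of (convex hull S)"
  shows "G = convex hull (S \<inter> G)"
proof -
  obtain S' where S': "S' \<subseteq> S" "G = convex hull S'"
    using face_of_convex_hull_subset[OF finite_imp_compact[OF assms(1)] assms(2)] .
  then have "S' \<subseteq> S \<inter> G" using hull_subset by fastforce
  then have "G \<subseteq> convex hull (S \<inter> G)" using S'(2) hull_mono by blast
  moreover have "convex hull (S \<inter> G) \<subseteq> G"
    using face_of_imp_convex[OF assms(2)] by (intro hull_minimal) auto
  ultimately show ?thesis by blast
qed

lemma edges_at_face:
  assumes "G face_of P"
  shows "edges_at G v = {E \<in> edges_at P v. E \<subseteq> G}"
  using face_of_face[OF assms] by (auto simp: edges_at_def edge_of_def)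

text \<open>
  The coordinates of \<open>x - v\<close> in the edge basis \<open>B\<close> are nonnegative on the polytope by
  \<open>convex_hull_subset_edge_cone\<close>. The same lemma for \<open>G\<close> shows that on \<open>G\<close> the coordinates belonging
  to \<open>B - B\<^sub>G\<close> vanish. So the dual vector of any \<open>b \<in> B - B\<^sub>G\<close> lies in \<open>\<sigma>\<close>, and a lattice vector orthogonal to
  \<open>\<sigma>\<close> has no component along \<open>b\<close>.
\<close>

lemma lattice_basis_face:
  fixes S :: "'a::euclidean_space set"
  assumes M: "full_lattice M" and S: "finite S" "S \<subseteq> M" and \<sigma>: "\<sigma> \<in> normal_fan (convex hull S)"
    and w: "\<And>E. E \<in> edges_at (convex hull S) v \<Longrightarrow> w E \<in> E \<inter> S"
    and B: "lattice_basis ((\<lambda>E. w E - v) ` edges_at (convex hull S) v) M"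
  defines "G \<equiv> cone_face (convex hull S) \<sigma>"
  defines "B \<equiv> (\<lambda>E. w E - v) ` edges_at (convex hull S) v"
    and "B\<^sub>G \<equiv> (\<lambda>E. w E - v) ` edges_at G v"
  assumes v: "v extreme_point_of G"
  shows "lattice_basis B\<^sub>G (M \<inter> orthogonal_comp \<sigma>)"
    and "\<And>x b. x \<in> convex hull S \<Longrightarrow> b \<in> B \<Longrightarrow> 0 \<le> representation B (x - v) b"
    and "\<And>x. x \<in> convex hull S \<Longrightarrow> x \<in> G \<longleftrightarrow> (\<forall>b\<in>B - B\<^sub>G. representation B (x - v) b = 0)"
proof -
  let ?P = "convex hull S"
  note Gf = cone_face_normal_fan[OF convex_convex_hull \<sigma>, folded G_def]
  have vP: "v extreme_point_of ?P" and vG: "v \<in> G" using v extreme_point_of_face[OF Gf(1)] by auto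
  have edges_G: "edges_at G v = {E \<in> edges_at ?P v. E \<subseteq> G}" by (rule edges_at_face[OF Gf(1)])
  have BG: "B\<^sub>G \<subseteq> B" by (auto simp: B_def B\<^sub>G_def edges_G)
  note B' = B[folded B_def]
  have indB: "independent B" and spanB: "span B = UNIV" and M_eq: "int_span B = M"
    using B' M lattice_basis_closed(7)[OF B'] by (auto simp: lattice_basis_def full_lattice_def)
  have finB: "finite B" using indB by (rule independent_imp_finite)
  have w_ne: "w E \<noteq> v" if "E \<in> edges_at ?P v" for E
  proof
    assume "w E = v"
    then have "0 \<in> B" using that by (force simp: B_def)
    then show False using indB dependent_zero by blast
  qed
  have lin: "linear (\<lambda>x. representation B x b)" for b
    by (rule linearI) (simp_all add: real_vector.representation_add[OF indB] real_vector.representation_scale[OF indB] spanB)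
  have rep_B: "representation B b' b = (if b = b' then 1 else 0)" if "b' \<in> B" for b b'
    using real_vector.representation_basis[OF indB that] by simp

  show nonneg: "0 \<le> representation B (x - v) b" if "x \<in> ?P" for x b
  proof (rule convex_cone_hull_nonneg[OF lin])
    show "x - v \<in> convex_cone hull B"
      unfolding B_def using w w_ne that by (intro convex_hull_subset_edge_cone[OF S(1) vP]) auto
  qed (simp add: rep_B)
  have zero: "representation B (x - v) b = 0" if x: "x \<in> G" and b: "b \<in> B - B\<^sub>G" for x b
  proof -
    have G_eq: "G = convex hull (S \<inter> G)" by (rule face_of_convex_hull_eq[OF S(1) Gf(1)])
    have K: "x - v \<in> convex_cone hull B\<^sub>G"
      unfolding B\<^sub>G_def using convex_hull_subset_edge_cone[of "S \<inter> G" v w x] S(1) v x w w_ne edges_G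
      by (auto simp flip: G_eq)
    \<comment> \<open>The functional and its negative are both nonnegative on the generators of the cone of \<open>G\<close>.\<close>
    have rep0: "representation B b' b = 0" if "b' \<in> B\<^sub>G" for b'
      using that b BG rep_B by auto
    have "0 \<le> representation B (x - v) b"
      by (rule convex_cone_hull_nonneg[OF lin _ K]) (simp add: rep0)
    moreover have "0 \<le> - representation B (x - v) b"
      by (rule convex_cone_hull_nonneg[OF linear_compose_neg[OF lin] _ K]) (simp add: rep0)
    ultimately show ?thesis by simp
  qed

  have BG_orth: "B\<^sub>G \<subseteq> orthogonal_comp \<sigma>"
  proof
    fix b assume "b \<in> B\<^sub>G"
    then obtain E where E: "E \<in> edges_at ?P v" "E \<subseteq> G" "b = w E - v" by (auto simp: B\<^sub>G_def edges_G)
    then have "w E \<in> G" using w by auto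
    then show "b \<in> orthogonal_comp \<sigma>"
      unfolding E(3) using vG unfolding G_def by (rule diff_in_orthogonal_comp)
  qed
  have span_BG: "span B\<^sub>G \<subseteq> orthogonal_comp \<sigma>"
    by (rule span_minimal[OF BG_orth subspace_orthogonal_comp])
  have finBG: "finite B\<^sub>G" using BG finB finite_subset by blast
  have decomp: "x = (\<Sum>b\<in>B\<^sub>G. representation B x b *\<^sub>R b)"
    if "\<And>b. b \<in> B - B\<^sub>G \<Longrightarrow> representation B x b = 0" for x
  proof -
    have "x = (\<Sum>b\<in>B. representation B x b *\<^sub>R b)"
      using real_vector.sum_representation_eq[OF indB _ finB, of x] spanB by simp
    also have "\<dots> = (\<Sum>b\<in>B\<^sub>G. representation B x b *\<^sub>R b)"
      using that BG finB by (intro sum.mono_neutral_right) auto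
    finally show ?thesis .
  qed

  show "x \<in> G \<longleftrightarrow> (\<forall>b\<in>B - B\<^sub>G. representation B (x - v) b = 0)" if x: "x \<in> ?P" for x
  proof
    assume "\<forall>b\<in>B - B\<^sub>G. representation B (x - v) b = 0"
    then have "x - v = (\<Sum>b\<in>B\<^sub>G. representation B (x - v) b *\<^sub>R b)" by (intro decomp) simp
    then have "x - v \<in> span B\<^sub>G"
      by (rule ssubst[of _ _ "\<lambda>y. y \<in> span B\<^sub>G"]) (intro span_sum span_scale span_base)
    then have "u \<bullet> (x - v) = 0" if "u \<in> \<sigma>" for u
      using span_BG that by (auto simp: mem_orthogonal_comp_iff)
    then show "x \<in> G"
      using x vG by (auto simp: G_def cone_face_def inner_diff_right)
  qed (use zero in blast)

  show "lattice_basis B\<^sub>G (M \<inter> orthogonal_comp \<sigma>)"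
    unfolding lattice_basis_def
  proof
    show "independent B\<^sub>G" using indB BG by (rule independent_mono)
    show "int_span B\<^sub>G = M \<inter> orthogonal_comp \<sigma>"
    proof
      show "int_span B\<^sub>G \<subseteq> M \<inter> orthogonal_comp \<sigma>"
      proof
        fix x assume x: "x \<in> int_span B\<^sub>G"
        then obtain c where "x = (\<Sum>b\<in>B\<^sub>G. of_int (c b) *\<^sub>R b)" by (rule int_spanE)
        also have "\<dots> = (\<Sum>b\<in>B. of_int (if b \<in> B\<^sub>G then c b else 0) *\<^sub>R b)"
          using BG finB by (intro sum.mono_neutral_cong_left) auto
        finally have "x \<in> M" using int_spanI[of "\<lambda>b. if b \<in> B\<^sub>G then c b else 0" B] M_eq by simp
        moreover have "x \<in> orthogonal_comp \<sigma>" using x int_span_subset_span span_BG by blast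
        ultimately show "x \<in> M \<inter> orthogonal_comp \<sigma>" by blast
      qed
      show "M \<inter> orthogonal_comp \<sigma> \<subseteq> int_span B\<^sub>G"
      proof
        fix x assume x: "x \<in> M \<inter> orthogonal_comp \<sigma>"
        have rep0: "representation B x b = 0" if b: "b \<in> B - B\<^sub>G" for b
        proof -
          \<comment> \<open>The vector representing the coordinate functional with respect to the inner product.\<close>
          define u where "u = adjoint (\<lambda>x. representation B x b) (1 :: real)"
          have u: "u \<bullet> y = representation B y b" for y
            using adjoint_works[OF lin, of y b 1] by (simp add: u_def inner_commute)
          have "u \<in> face_cone ?P G"
            unfolding face_cone_def
          proof (intro CollectI ballI)
            fix x y assume "x \<in> ?P" "y \<in> G"
            then show "0 \<le> u \<bullet> (x - y)"
              using nonneg[of x b] zero[OF _ b, of y] by (simp add: u linear_diff[OF lin])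
          qed
          then have "u \<in> \<sigma>" using Gf(3) by blast
          then show ?thesis using x u by (auto simp: mem_orthogonal_comp_iff)
        qed
        have "representation B x b \<in> \<int>" for b
          using representation_int_span[OF indB, of x] x M_eq by auto
        then have "\<forall>b. \<exists>c. representation B x b = of_int c" by (auto simp: Ints_def)
        then obtain c where "\<And>b. representation B x b = of_int (c b)" by metis
        then have "x = (\<Sum>b\<in>B\<^sub>G. of_int (c b) *\<^sub>R b)" using decomp[OF rep0] by simp
        then show "x \<in> int_span B\<^sub>G" using int_spanI[of c "B\<^sub>G"] by simp
      qed
    qed
  qed
qed

section \<open>Translation and the initial part\<close>

lemma edges_at_translation: "edges_at ((+) a ` P) (a + v) = (`) ((+) a) ` edges_at P v"
proof -
  have *: "(+) a ` E \<in> edges_at ((+) a ` P) (a + v) \<longleftrightarrow> E \<in> edges_at P v" for E P and a v :: 'a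
    by (auto simp: edges_at_def edge_of_def aff_dim_translation_eq)
  show ?thesis
  proof (intro equalityI subsetI)
    fix E assume E: "E \<in> edges_at ((+) a ` P) (a + v)"
    have "E = (+) a ` (+) (- a) ` E" by (simp add: image_image)
    then show "E \<in> (`) ((+) a) ` edges_at P v" using E * by (metis image_eqI)
  qed (use * in auto)
qed

text \<open>
  The support of the translated initial part lies in \<open>M \<inter> \<sigma>\<^sup>\<bottom>\<close>, but \<open>supp(p) \<inter> G\<close> in general does not. The
  vertex condition only involves differences of points and can be verified before translating.
\<close>

lemma unimodular_translationI:
  fixes T :: "'a::euclidean_space set"
  assumes "finite T" "(+) a ` T \<subseteq> L"
    and vert: "\<And>v. v extreme_point_of (convex hull T) \<Longrightarrow>
      \<exists>w. (\<forall>E\<in>edges_at (convex hull T) v. w E \<in> E \<inter> T) \<and>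
        inj_on (\<lambda>E. w E - v) (edges_at (convex hull T) v) \<and>
        lattice_basis ((\<lambda>E. w E - v) ` edges_at (convex hull T) v) L"
  shows "unimodular L ((+) a ` T)"
  unfolding unimodular_def
proof (intro conjI allI impI)
  let ?P = "convex hull T"
  fix v' assume "v' extreme_point_of (convex hull ((+) a ` T))"
  then have v': "v' extreme_point_of ((+) a ` ?P)" by (simp only: convex_hull_translation)
  define v where "v = v' - a"
  have v'_eq: "v' = a + v" by (simp add: v_def)
  have "v extreme_point_of ?P" using v' unfolding v'_eq by (simp add: extreme_point_of_translation_eq)
  then obtain w where w: "\<And>E. E \<in> edges_at ?P v \<Longrightarrow> w E \<in> E \<inter> T"
      "inj_on (\<lambda>E. w E - v) (edges_at ?P v)" "lattice_basis ((\<lambda>E. w E - v) ` edges_at ?P v) L"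
    using vert by meson
  define w' where "w' E = a + w ((+) (- a) ` E)" for E
  have w': "w' ((+) a ` E) = a + w E" for E by (simp add: w'_def image_image)
  have comp: "(\<lambda>E. w' E - v') \<circ> (`) ((+) a) = (\<lambda>E. w E - v)" by (auto simp: w' v'_eq)
  show "\<exists>w. (\<forall>E\<in>edges_at (convex hull ((+) a ` T)) v'. w E \<in> E \<inter> (+) a ` T) \<and>
      inj_on (\<lambda>E. w E - v') (edges_at (convex hull ((+) a ` T)) v') \<and>
      lattice_basis ((\<lambda>E. w E - v') ` edges_at (convex hull ((+) a ` T)) v') L"
    unfolding convex_hull_translation v'_eq edges_at_translation
  proof (intro exI[of _ w'] conjI)
    show "\<forall>E\<in>(`) ((+) a) ` edges_at ?P v. w' E \<in> E \<inter> (+) a ` T" using w(1) by (auto simp: w')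
    show "inj_on (\<lambda>E. w' E - (a + v)) ((`) ((+) a) ` edges_at ?P v)"
      by (rule inj_on_imageI) (use w(2) comp in \<open>simp add: v'_eq\<close>)
    show "lattice_basis ((\<lambda>E. w' E - (a + v)) ` (`) ((+) a) ` edges_at ?P v) L"
      using w(3) by (simp add: image_image w')
  qed
qed (use assms in auto)

lemma init_part_eq_restrict: "init_part \<sigma> p = restrict_supp (cone_face (newton_polytope p) \<sigma>) p"
proof (rule laurent_eqI)
  fix m
  let ?A = "{m. m \<in> laurent_supp p \<and> m \<in> cone_face (newton_polytope p) \<sigma>}"
  have "finite ?A" by simp
  then show "laurent_coeff (init_part \<sigma> p) m =
      laurent_coeff (restrict_supp (cone_face (newton_polytope p) \<sigma>) p) m"
    by (auto simp: init_part_def laurent_coeff_monom in_laurent_supp_iff sum.delta indicator_def)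
qed

theorem proposition3p19:
  fixes M :: "'a::euclidean_space set" and p :: "'a laurent" and \<sigma> :: "'a set"
  assumes "full_lattice M"
    and "p \<in> \<complex>[M]" and "p \<noteq> 0"
    and "unimodular M (laurent_supp p)"
    and "GEC M p"
    and "\<sigma> \<in> normal_fan (newton_polytope p)"
  shows "\<forall>m \<in> laurent_supp (init_part \<sigma> p).
    let p\<^sub>\<sigma> = laurent_monom 1 (- m) * init_part \<sigma> p; L = M \<inter> orthogonal_comp \<sigma>
    in p\<^sub>\<sigma> \<in> \<complex>[L] \<and> unimodular L (laurent_supp p\<^sub>\<sigma>) \<and> GEC L p\<^sub>\<sigma>"
proof
  define S where "S = laurent_supp p"
  define G where "G = cone_face (newton_polytope p) \<sigma>"
  define L where "L = M \<inter> orthogonal_comp \<sigma>"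
  let ?P = "convex hull S"
  fix m assume "m \<in> laurent_supp (init_part \<sigma> p)"
  define p\<^sub>\<sigma> where "p\<^sub>\<sigma> = laurent_monom 1 (- m) * init_part \<sigma> p"
  have P_eq: "newton_polytope p = ?P" by (simp add: newton_polytope_def S_def)
  have G_eq: "G = cone_face ?P \<sigma>" by (simp add: G_def P_eq)
  have \<sigma>: "\<sigma> \<in> normal_fan ?P" using assms(6) by (simp add: P_eq)
  note Gf = cone_face_normal_fan[OF convex_convex_hull \<sigma>, folded G_eq]
  have S: "finite S" "S \<subseteq> M" using assms(2) by (auto simp: S_def laurent_ring_def)
  have SP: "S \<subseteq> ?P" by (rule hull_subset)
  have supp_init: "laurent_supp (init_part \<sigma> p) = S \<inter> G"
    by (simp add: init_part_eq_restrict laurent_supp_restrict S_def G_def)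
  have m: "m \<in> S \<inter> G" using \<open>m \<in> _\<close> supp_init by simp
  have supp: "laurent_supp p\<^sub>\<sigma> = (+) (- m) ` (S \<inter> G)"
    by (simp add: p\<^sub>\<sigma>_def laurent_supp_monom_mult supp_init)
  have hullG: "convex hull (S \<inter> G) = G"
    using face_of_convex_hull_eq[OF S(1) Gf(1)] by simp
  have edges_G: "edges_at G v = {E \<in> edges_at ?P v. E \<subseteq> G}" for v by (rule edges_at_face[OF Gf(1)])
  have vertex: "\<exists>w. (\<forall>E\<in>edges_at ?P v. w E \<in> E \<inter> S) \<and> inj_on (\<lambda>E. w E - v) (edges_at ?P v) \<and>
      lattice_basis ((\<lambda>E. w E - v) ` edges_at ?P v) M" if "v extreme_point_of G" for v
    using assms(4) that extreme_point_of_face[OF Gf(1)] by (auto simp: unimodular_def S_def)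

  obtain v where v: "v extreme_point_of G"
  proof -
    have "compact G" using hullG S(1) by (metis finite_Int finite_imp_compact_convex_hull)
    then show thesis
      using extreme_point_exists_convex[of G] Gf(2) face_of_imp_convex[OF Gf(1)] that by blast
  qed
  obtain w where w: "\<And>E. E \<in> edges_at ?P v \<Longrightarrow> w E \<in> E \<inter> S"
      and B_basis: "lattice_basis ((\<lambda>E. w E - v) ` edges_at ?P v) M"
    using vertex[OF v] by meson
  define B where "B = (\<lambda>E. w E - v) ` edges_at ?P v"
  define B\<^sub>G where "B\<^sub>G = (\<lambda>E. w E - v) ` edges_at G v"
  note face = lattice_basis_face[OF assms(1) S \<sigma> w B_basis, folded G_eq, OF _ v, folded B_def B\<^sub>G_def L_def]
  have B: "lattice_basis B M" using B_basis by (simp add: B_def)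
  have L: "lattice_basis B\<^sub>G L" by (rule face(1))
  have nonneg: "0 \<le> representation B (x - v) b" if "x \<in> ?P" "b \<in> B" for x b using face(2) that by blast
  have G_iff: "x \<in> G \<longleftrightarrow> (\<forall>b\<in>B - B\<^sub>G. representation B (x - v) b = 0)" if "x \<in> ?P" for x using face(3) that by blast
  note Mc = lattice_basis_closed[OF B] and Lc = lattice_basis_closed[OF L]
  have indB: "independent B" and spanB: "span B = UNIV"
    using B assms(1) Mc(7) by (auto simp: lattice_basis_def full_lattice_def)
  have BG: "B\<^sub>G \<subseteq> B" by (auto simp: B_def B\<^sub>G_def edges_G)
  have vS: "v \<in> S \<inter> G" using extreme_point_of_convex_hull[of v "S \<inter> G"] v hullG by simp
  have diffL: "x - y \<in> L" if "x \<in> S \<inter> G" "y \<in> S \<inter> G" for x y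
    using that S(2) Mc(4) diff_in_orthogonal_comp[of x ?P \<sigma> y] by (auto simp: L_def G_eq)
  have B_supp: "b + v \<in> S" if "b \<in> B" for b using that w by (auto simp: B_def)
  have BG_supp: "b + v \<in> S \<inter> G" if "b \<in> B\<^sub>G" for b using that w by (auto simp: B\<^sub>G_def edges_G)
  have p\<^sub>\<sigma>_L: "p\<^sub>\<sigma> \<in> \<complex>[L]"
    using diffL[OF _ m] by (auto simp: laurent_ring_def supp)

  have "unimodular L (laurent_supp p\<^sub>\<sigma>)"
    unfolding supp
  proof (rule unimodular_translationI)
    show "finite (S \<inter> G)" "(+) (- m) ` (S \<inter> G) \<subseteq> L" using S(1) diffL[OF _ m] by auto
    fix z assume "z extreme_point_of (convex hull (S \<inter> G))"
    then have z: "z extreme_point_of G" by (simp add: hullG)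
    obtain w where w: "\<And>E. E \<in> edges_at ?P z \<Longrightarrow> w E \<in> E \<inter> S" "inj_on (\<lambda>E. w E - z) (edges_at ?P z)"
        "lattice_basis ((\<lambda>E. w E - z) ` edges_at ?P z) M"
      using vertex[OF z] by meson
    show "\<exists>w. (\<forall>E\<in>edges_at (convex hull (S \<inter> G)) z. w E \<in> E \<inter> (S \<inter> G)) \<and>
        inj_on (\<lambda>E. w E - z) (edges_at (convex hull (S \<inter> G)) z) \<and>
        lattice_basis ((\<lambda>E. w E - z) ` edges_at (convex hull (S \<inter> G)) z) L"
      unfolding hullG
    proof (intro exI[of _ w] conjI)
      show "\<forall>E\<in>edges_at G z. w E \<in> E \<inter> (S \<inter> G)" using w(1) edges_G by auto
      show "inj_on (\<lambda>E. w E - z) (edges_at G z)" by (rule inj_on_subset[OF w(2)]) (auto simp: edges_G)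
      show "lattice_basis ((\<lambda>E. w E - z) ` edges_at G z) L"
        using lattice_basis_face(1)[OF assms(1) S \<sigma> w(1) w(3), folded G_eq, OF _ z] by (simp add: L_def)
    qed
  qed
  moreover have "GEC L p\<^sub>\<sigma>"
  proof -
    have fin: "finite B\<^sub>G" "finite (B - B\<^sub>G)" using independent_imp_finite[OF indB] BG finite_subset by auto
    obtain bs1 where bs1: "set bs1 = B\<^sub>G" "distinct bs1" using finite_distinct_list[OF fin(1)] by blast
    obtain bs2 where bs2: "set bs2 = B - B\<^sub>G" "distinct bs2" using finite_distinct_list[OF fin(2)] by blast
    \<comment> \<open>The edges inside \<open>G\<close> come first, so that truncation at \<open>?r\<close> separates them from the others.\<close>
    define bs where "bs = bs1 @ bs2"
    have bs: "set bs = B" "distinct bs" using bs1 bs2 BG by (auto simp: bs_def)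
    let ?n = "length bs" and ?r = "length bs1"
    have rn: "?r \<le> ?n" by (simp add: bs_def)
    define q where "q = laurent_monom 1 (- v) * p"
    have supp_q: "laurent_supp q = (+) (- v) ` S" by (simp add: q_def laurent_supp_monom_mult S_def)
    interpret nonneg_coordinates "basis_coord bs" "(!) bs" ?n q
    proof (rule nonneg_coordinates.intro)
      show "linear (basis_coord bs j)" for j
        unfolding basis_coord_def bs(1)
        by (rule linearI) (simp_all add: real_vector.representation_add[OF indB] real_vector.representation_scale[OF indB] spanB)
      show "basis_coord bs i (bs ! j) = (if i = j then 1 else 0)" if "i < ?n" "j < ?n" for i j
        using that bs real_vector.representation_basis[OF indB, of "bs ! j"]
        by (auto simp: basis_coord_def nth_eq_iff_index_eq)
      show "basis_coord bs j x \<in> \<nat>" if x: "x \<in> laurent_supp q" and j: "j < ?n" for x j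
      proof -
        obtain s where s: "s \<in> S" "x = s - v" using x supp_q by auto
        have "bs ! j \<in> B" using j bs by auto
        then have "0 \<le> basis_coord bs j x" using nonneg[of s] s SP by (auto simp: basis_coord_def bs(1))
        moreover have "x \<in> int_span B" using s S(2) vS Mc(4) B by (auto simp: lattice_basis_def)
        then have "basis_coord bs j x \<in> \<int>"
          unfolding basis_coord_def bs(1) by (rule representation_int_span[OF indB])
        ultimately show ?thesis by (auto simp: Nats_altdef2)
      qed
      show "0 \<in> laurent_supp q" using vS by (force simp: supp_q)
      show "bs ! j \<in> laurent_supp q" if "j < ?n" for j
        using B_supp[of "bs ! j"] that bs by (force simp: supp_q)
    qed
    let ?q = "restrict_supp {x. height ?r x = 0} q"
    have q_eq: "?q = laurent_monom 1 (- v) * init_part \<sigma> p"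
    proof -
      have "s - v \<in> {x. height ?r x = 0} \<longleftrightarrow> s \<in> G" if s: "s \<in> S" for s
      proof -
        have x: "s - v \<in> laurent_supp q" using s by (auto simp: supp_q)
        have "height ?r (s - v) = 0 \<longleftrightarrow> (\<forall>j\<in>{?r..<?n}. basis_coord bs j (s - v) = 0)"
          unfolding height_def by (rule sum_nonneg_eq_0_iff) (auto intro: coord_nonneg[OF x])
        also have "\<dots> \<longleftrightarrow> (\<forall>b\<in>set bs2. representation B (s - v) b = 0)"
        proof -
          have "(\<lambda>j. bs ! j) ` {?r..<?n} = set bs2"
          proof -
            have "{?r..<?n} = (+) ?r ` {..<length bs2}"
              by (simp add: bs_def lessThan_atLeast0 add.commute)
            then have "(\<lambda>j. bs ! j) ` {?r..<?n} = (!) bs2 ` {..<length bs2}"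
              by (simp add: image_image bs_def)
            then show ?thesis by (auto simp: set_conv_nth)
          qed
          then have "(\<forall>b\<in>set bs2. representation B (s - v) b = 0) \<longleftrightarrow>
              (\<forall>b\<in>(\<lambda>j. bs ! j) ` {?r..<?n}. representation B (s - v) b = 0)" by (rule arg_cong[OF sym])
          then show ?thesis by (simp only: basis_coord_def bs(1) ball_simps)
        qed
        also have "\<dots> \<longleftrightarrow> s \<in> G" using G_iff[of s] s SP bs2(1) by auto
        finally show ?thesis by simp
      qed
      then show ?thesis
        unfolding q_def weighted_monom_mult init_part_eq_restrict
        by (intro arg_cong[of _ _ "(*) _"] weighted_cong) (auto simp: S_def G_def indicator_def)
    qed
    have supp_q\<^sub>r: "laurent_supp ?q = (+) (- v) ` (S \<inter> G)"
      unfolding q_eq laurent_supp_monom_mult supp_init ..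
    have q\<^sub>r_L: "?q \<in> \<complex>[L]" by (simp only: laurent_ring_def mem_Collect_eq supp_q\<^sub>r) (use diffL[OF _ vS] in auto)
    let ?h = "bordered_hessian (basis_coord bs1) ?r ?q"
    have h_L: "?h \<in> \<complex>[L]" by (rule bordered_hessian_in_ring[OF Lc(2,1) q\<^sub>r_L])

    have "difference_lattice M p = M"
      using B
    proof (rule difference_lattice_eqI)
      fix b assume "b \<in> B"
      then show "\<exists>x\<in>laurent_supp p. \<exists>y\<in>laurent_supp p. b = x - y"
        using B_supp vS by (intro bexI[of _ "b + v"] bexI[of _ v]) (auto simp: S_def)
    qed
    then obtain \<kappa> Q where \<kappa>: "\<kappa> > 0" "q ^ \<kappa> = bordered_hessian (basis_coord bs) ?n q * Q"
      using GEC_iff_bordered_hessian[of bs M p v] bs B assms(2,3,5) vS S(2) by (auto simp: q_def)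
    then obtain Q' where Q': "?q ^ \<kappa> = bordered_hessian (basis_coord bs) ?r ?q * Q'"
      using bordered_hessian_dvd_power_restrict[OF rn \<kappa>(2)] by blast
    also have "bordered_hessian (basis_coord bs) ?r ?q = ?h"
    proof (rule bordered_hessian_cong)
      fix j x assume j: "j < ?r" and "x \<in> laurent_supp ?q"
      then have "x \<in> L" using q\<^sub>r_L by (auto simp: laurent_ring_def)
      then have "x \<in> span B\<^sub>G" using Lc(7) span_superset by blast
      then have "representation B x = representation B\<^sub>G x"
        by (rule real_vector.representation_extend[OF indB _ BG])
      then show "basis_coord bs j x = basis_coord bs1 j x"
        using j bs bs1 by (simp add: basis_coord_def bs_def nth_append)
    qed
    finally have eq: "?q ^ \<kappa> = ?h * Q'" .
    \<comment> \<open>The cofactor \<open>Q'\<close> lies a priori only in the group algebra of the whole space.\<close>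
    have "?q ^ \<kappa> \<in> \<complex>[L]" by (rule laurent_ring_power[OF Lc(2,1) q\<^sub>r_L])
    then have "?q ^ \<kappa> = restrict_supp L (?q ^ \<kappa>)" by (auto simp: restrict_supp_id laurent_ring_def)
    also have "\<dots> = ?h * restrict_supp L Q'"
      unfolding eq by (rule restrict_supp_mult_subring[OF Lc(2,4) h_L])
    finally have "\<exists>\<kappa>>0. \<exists>Q\<in>\<complex>[L]. ?q ^ \<kappa> = ?h * Q"
      using \<kappa>(1) by (intro exI[of _ \<kappa>] conjI bexI[of _ "restrict_supp L Q'"])
        (auto simp: laurent_ring_def laurent_supp_restrict)
    \<comment> \<open>Since \<open>p\<^sub>\<sigma>\<close> is already shifted by \<open>m\<close>, moving \<open>v\<close> to the origin takes a shift by \<open>v - m \<in> L\<close>.\<close>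
    moreover have "?q = laurent_monom 1 (- (v - m)) * p\<^sub>\<sigma>"
      by (simp add: q_eq p\<^sub>\<sigma>_def mult.assoc[symmetric] laurent_monom_mult)
    moreover have "difference_lattice L p\<^sub>\<sigma> = L"
      using L
    proof (rule difference_lattice_eqI)
      fix b assume "b \<in> B\<^sub>G"
      then show "\<exists>x\<in>laurent_supp p\<^sub>\<sigma>. \<exists>y\<in>laurent_supp p\<^sub>\<sigma>. b = x - y"
        using BG_supp vS unfolding supp
        by (intro bexI[of _ "- m + (b + v)"] bexI[of _ "- m + v"]) auto
    qed
    moreover have "p\<^sub>\<sigma> \<noteq> 0" using m supp by (auto simp: laurent_supp_eq_empty_iff[symmetric])
    ultimately show ?thesis
      using GEC_iff_bordered_hessian[OF bs1(2), of L p\<^sub>\<sigma> "v - m"] L bs1(1) p\<^sub>\<sigma>_L diffL[OF vS m] by simp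
  qed
  ultimately show "let p\<^sub>\<sigma> = laurent_monom 1 (- m) * init_part \<sigma> p; L = M \<inter> orthogonal_comp \<sigma>
    in p\<^sub>\<sigma> \<in> \<complex>[L] \<and> unimodular L (laurent_supp p\<^sub>\<sigma>) \<and> GEC L p\<^sub>\<sigma>"
    using p\<^sub>\<sigma>_L unfolding p\<^sub>\<sigma>_def L_def Let_def by blast
qed

end
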